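(* Let $C>0$ and consider a GSAW with nearest-neighbor weighting (with constant $C$) on $L_\infty$. The expected number of steps taken before it terminates is $$\frac{2\left(6C^5+41C^4+56C^3+51C^2+38C+12\right)}{3C(C+1)(2C^2+C+1)},$$ with variance $$\frac{2\left(72C^{10}+360C^9+1312C^8+2975C^7+4693C^6+5864C^5+5822C^4+4551C^3+2773C^2+1242C+288\right)}{9C^2(C+1)^2(2C^2+C+1)^2}.$$ The expected width at termination is $$\frac{6C^4+32C^3+28C^2+28C+18}{6C^3+3C^2+3C},$$ with variance $$\frac{2\left(18C^8+54C^7+229C^6+445C^5+590C^4+686C^3+541C^2+315C+162\right)}{9C^2(2C^2+C+1)^2}.$$
   Context: $L_\infty$ is the graph with vertex set $\{(a,b): a\in\mathbb{Z},\ b\in\{1,2\}\}$, where $(a,b)$ and $(a',b')$ are adjacent iff ($b=b'$ and $|a-a'|=1$) or ($a=a'$ and $b\ne b'$). All starting vertices are equivalent by symmetry. GSAW (growing self-avoiding walk) with nearest-neighbor weighting (constant $C>0$): the random process which starts at a given vertex and, if the path so far is $P=(v_1,\dots,v_n)$, assigns to each unvisited vertex $w$ the energy $E(w)=C^{k(w)}$, where $k(w)$ is the number of neighbors of $w$ lying in $P\setminus\{v_n\}$. The next vertex is chosen among the unvisited neighbors of $v_n$, with $w$ chosen with probability proportional to $E(w)$. The walk terminates when $v_n$ has no unvisited neighbor. The width is the difference between the largest and smallest first coordinates of the vertices visited. *)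

theory Defs
  imports "HOL-Probability.Probability"
begin

definition ladder_verts :: "(int \<times> nat) set" where
  "ladder_verts = {(a, b). b \<in> {1, 2}}"

definition ladder_adj :: "int \<times> nat \<Rightarrow> int \<times> nat \<Rightarrow> bool" where
  "ladder_adj v w \<longleftrightarrow> v \<in> ladder_verts \<and> w \<in> ladder_verts \<and>
     (snd v = snd w \<and> \<bar>fst v - fst w\<bar> = 1 \<or> fst v = fst w \<and> snd v \<noteq> snd w)"

definition avail :: "('v \<Rightarrow> 'v \<Rightarrow> bool) \<Rightarrow> 'v list \<Rightarrow> 'v set" where
  "avail adj P = {w. adj (last P) w \<and> w \<notin> set P}"

definition energy :: "('v \<Rightarrow> 'v \<Rightarrow> bool) \<Rightarrow> real \<Rightarrow> 'v list \<Rightarrow> 'v \<Rightarrow> real" where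
  "energy adj C P w = C ^ card {u \<in> set P - {last P}. adj w u}"

definition gsaw_prob :: "('v \<Rightarrow> 'v \<Rightarrow> bool) \<Rightarrow> real \<Rightarrow> 'v list \<Rightarrow> 'v \<Rightarrow> real" where
  "gsaw_prob adj C P w = energy adj C P w / (\<Sum>u\<in>avail adj P. energy adj C P u)"

text \<open>
  A growing self-avoiding walk is given by random paths \<open>X 0, X 1, \<dots>\<close>, where \<open>X n\<close> is the whole
  path after \<open>n\<close> steps, oldest vertex first; after termination the path stays constant. As \<open>X n\<close>
  determines the earlier history, it suffices to condition on \<open>X n\<close>.
\<close>
locale gsaw = prob_space M for M :: "'w measure" +
  fixes adj :: "'v \<Rightarrow> 'v \<Rightarrow> bool" and C :: real and v0 :: 'v and X :: "nat \<Rightarrow> 'w \<Rightarrow> 'v list"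
  assumes random_path: "\<And>n. random_variable (count_space UNIV) (X n)"
    and start: "AE \<omega> in M. X 0 \<omega> = [v0]"
    and step: "\<And>n P w. \<P>(\<omega> in M. X n \<omega> = P) > 0 \<Longrightarrow> w \<in> avail adj P \<Longrightarrow>
        \<P>(\<omega> in M. X (Suc n) \<omega> = P @ [w] \<bar> X n \<omega> = P) = gsaw_prob adj C P w"
    and stop: "\<And>n. AE \<omega> in M. avail adj (X n \<omega>) = {} \<longrightarrow> X (Suc n) \<omega> = X n \<omega>"

text \<open>
  A path \<open>X n\<close> has \<open>n + 1\<close> vertices until termination; \<open>num_steps\<close> counts edges. It is
  meaningful only for outcomes on which the walk terminates.
\<close>
definition num_steps :: "('v \<Rightarrow> 'v \<Rightarrow> bool) \<Rightarrow> (nat \<Rightarrow> 'w \<Rightarrow> 'v list) \<Rightarrow> 'w \<Rightarrow> nat" where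
  "num_steps adj X \<omega> = (LEAST n. avail adj (X n \<omega>) = {})"

definition path_width :: "(int \<times> nat) list \<Rightarrow> int" where
  "path_width P = Max (fst ` set P) - Min (fst ` set P)"

definition final_width :: "(nat \<Rightarrow> 'w \<Rightarrow> (int \<times> nat) list) \<Rightarrow> 'w \<Rightarrow> int" where
  "final_width X \<omega> = path_width (X (num_steps ladder_adj X \<omega>) \<omega>)"

text \<open>Such processes exist, so statements about all of them are not vacuous.\<close>

lemma gsaw_exists:
  fixes adj :: "'v::countable \<Rightarrow> 'v \<Rightarrow> bool"
  assumes C: "C > 0" and fin: "\<And>v. finite {w. adj v w}"
  shows "\<exists>(M :: (nat \<times> 'v list \<Rightarrow> 'v list) measure) X. gsaw M adj C v0 X"
proof -
  define g where "g P = (if avail adj P = {} then return_pmf P else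
      map_pmf (\<lambda>w. P @ [w]) (embed_pmf (\<lambda>w. indicator (avail adj P) w * gsaw_prob adj C P w)))" for P
  have fa: "finite (avail adj P)" for P
    by (rule finite_subset[OF _ fin[of "last P"]]) (auto simp: avail_def)
  have epos: "energy adj C P w > 0" for P w
    using C by (simp add: energy_def)
  have pmf_g: "pmf (g P) (P @ [w]) = gsaw_prob adj C P w" if w: "w \<in> avail adj P" for P w
  proof -
    let ?f = "\<lambda>w. indicator (avail adj P) w * gsaw_prob adj C P w"
    have S: "(\<Sum>u\<in>avail adj P. energy adj C P u) > 0"
      using fa epos w by (intro sum_pos) auto
    have nn: "0 \<le> ?f u" for u
      using S epos[of P u] by (auto simp: gsaw_prob_def indicator_def intro!: divide_nonneg_pos less_imp_le)
    have "(\<integral>\<^sup>+u. ennreal (?f u) \<partial>count_space UNIV) = (\<integral>\<^sup>+u. ennreal (?f u) \<partial>count_space (avail adj P))"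
      by (subst nn_integral_count_space_indicator)
         (auto intro!: nn_integral_cong simp: indicator_def)
    also have "\<dots> = (\<Sum>u\<in>avail adj P. ennreal (?f u))"
      by (rule nn_integral_count_space_finite[OF fa])
    also have "\<dots> = ennreal (\<Sum>u\<in>avail adj P. ?f u)"
      using nn by (intro sum_ennreal) blast
    also have "(\<Sum>u\<in>avail adj P. ?f u) = (\<Sum>u\<in>avail adj P. gsaw_prob adj C P u)"
      by (intro sum.cong) auto
    also have "\<dots> = 1"
      using S by (simp add: gsaw_prob_def flip: sum_divide_distrib)
    finally have "pmf (embed_pmf ?f) w = ?f w"
      using nn by (intro pmf_embed_pmf) auto
    moreover have "pmf (map_pmf (\<lambda>w. P @ [w]) (embed_pmf ?f)) (P @ [w]) = pmf (embed_pmf ?f) w"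
      by (intro pmf_map_inj') (auto simp: inj_def)
    ultimately show ?thesis
      using w by (auto simp: g_def)
  qed
  define N where "N = (\<lambda>i :: nat \<times> 'v list. measure_pmf (g (snd i)))"
  have mN: "measurable L (N i) = measurable L (count_space UNIV)" for L :: "(nat \<times> 'v list \<Rightarrow> 'v list) measure" and i
    by (rule measurable_cong_sets) (auto simp: N_def)
  interpret N: product_prob_space N "UNIV :: (nat \<times> 'v list) set"
    unfolding N_def by unfold_locales
  define M where "M = PiM UNIV N"
  interpret M: prob_space M
    unfolding M_def by (rule N.P.prob_space_axioms)
  define X where "X = rec_nat (\<lambda>_. [v0]) (\<lambda>n Y \<omega>. \<omega> (n, Y \<omega> :: 'v list))"
  have X0: "X 0 \<omega> = [v0]" and XS: "X (Suc n) \<omega> = \<omega> (n, X n \<omega>)" for n \<omega>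
    by (simp_all add: X_def)
  have sp: "space M = UNIV"
    by (auto simp: M_def N_def space_PiM)
  have X_restr: "X n \<in> measurable (PiM ({..<n} \<times> UNIV) N) (count_space UNIV) \<and>
      (\<forall>\<omega> \<omega>'. (\<forall>i\<in>{..<n} \<times> UNIV. \<omega> i = \<omega>' i) \<longrightarrow> X n \<omega> = X n \<omega>')" (is "?P n \<and> ?Q n") for n
  proof
    show "?Q n"
    proof (induction n)
      case (Suc n)
      show ?case
      proof (intro allI impI)
        fix \<omega> \<omega>' :: "nat \<times> 'v list \<Rightarrow> 'v list" assume eq: "\<forall>i\<in>{..<Suc n} \<times> UNIV. \<omega> i = \<omega>' i"
        then have "X n \<omega> = X n \<omega>'" using Suc by auto
        with eq show "X (Suc n) \<omega> = X (Suc n) \<omega>'" by (simp add: XS)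
      qed
    qed (simp add: X0)
    have "\<forall>A. {..<n} \<times> UNIV \<subseteq> A \<longrightarrow> X n \<in> measurable (PiM A N) (count_space UNIV)"
    proof (induction n)
      case 0
      then show ?case by (auto simp: X_def)
    next
      case (Suc n)
      show ?case
      proof (intro allI impI)
        fix A :: "(nat \<times> 'v list) set" assume A: "{..<Suc n} \<times> UNIV \<subseteq> A"
        have 1: "(\<lambda>\<omega>. \<omega> (n, P)) \<in> measurable (PiM A N) (count_space UNIV)" for P
        proof -
          have "(n, P) \<in> A" using A by auto
          from measurable_component_singleton[OF this, of N] show ?thesis
            by (simp add: mN)
        qed
        have 2: "X n \<in> measurable (PiM A N) (count_space UNIV)"
          using Suc A by (auto simp: subset_eq)
        show "X (Suc n) \<in> measurable (PiM A N) (count_space UNIV)"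
          unfolding XS[abs_def]
          by (rule measurable_compose_countable[OF _ 2, where f="\<lambda>P \<omega>. \<omega> (n, P)"]) (rule 1)
      qed
    qed
    then show "?P n" by auto
  qed
  have meas_coord: "(\<lambda>\<omega>. \<omega> i) \<in> measurable M (count_space UNIV)" for i
    unfolding M_def using measurable_component_singleton[of i UNIV N] by (simp add: mN)
  have X_eq: "X n \<omega> = X n (restrict \<omega> ({..<n} \<times> UNIV))" for n \<omega>
    using X_restr[of n] by (auto simp: restrict_def)
  have mX: "X n \<in> measurable M (count_space UNIV)" for n
  proof -
    have "(\<lambda>\<omega>. X n (restrict \<omega> ({..<n} \<times> UNIV))) \<in> measurable M (count_space UNIV)"
      unfolding M_def using X_restr[of n]
      by (intro measurable_compose[OF measurable_restrict_subset]) auto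
    then show ?thesis using X_eq[of n] by (simp cong: measurable_cong)
  qed
  have ind: "M.indep_vars N (\<lambda>i \<omega>. \<omega> i) UNIV"
  proof (subst M.indep_vars_iff_distr_eq_PiM')
    show "distr M (PiM UNIV N) (\<lambda>\<omega>. \<lambda>i\<in>UNIV. \<omega> i) = PiM UNIV (\<lambda>i. distr M (N i) (\<lambda>\<omega>. \<omega> i))"
      using N.PiM_component by (simp add: M_def restrict_def distr_id)
  qed (use meas_coord in \<open>auto simp: mN\<close>)
  have coord: "\<P>(\<omega> in M. \<omega> i = Q) = pmf (g (snd i)) Q" for i Q
  proof -
    have "emeasure M {\<omega> \<in> space M. \<omega> i \<in> {Q}} = emeasure (N i) {Q}"
      unfolding M_def by (rule N.emeasure_PiM_Collect_single) (auto simp: N_def)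
    then show ?thesis
      by (simp add: N_def emeasure_pmf_single M.emeasure_eq_measure)
  qed
  have joint: "\<P>(\<omega> in M. \<omega> (n, P) = Q \<and> X n \<omega> = P) = pmf (g P) Q * \<P>(\<omega> in M. X n \<omega> = P)" for n P Q
  proof -
    let ?A = "{..<n} \<times> (UNIV :: 'v list set)" and ?B = "{(n, P)}"
    have "M.indep_var (PiM ?A N) (\<lambda>\<omega>. restrict (\<lambda>i. \<omega> i) ?A) (PiM ?B N) (\<lambda>\<omega>. restrict (\<lambda>i. \<omega> i) ?B)"
      by (rule M.indep_var_restrict[OF ind]) auto
    then have "M.indep_var (count_space UNIV) (X n \<circ> (\<lambda>\<omega>. restrict (\<lambda>i. \<omega> i) ?A)) 
        (N (n, P)) ((\<lambda>\<omega>. \<omega> (n, P)) \<circ> (\<lambda>\<omega>. restrict (\<lambda>i. \<omega> i) ?B))"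
      using conjunct1[OF X_restr[of n]] measurable_component_singleton[of "(n, P)" "{(n, P)}" N]
      by (intro M.indep_var_compose) auto
    then have "M.indep_var (count_space UNIV) (X n) (N (n, P)) (\<lambda>\<omega>. \<omega> (n, P))"
      unfolding comp_def X_eq[symmetric] by (simp add: restrict_def)
    from M.indep_varD[OF this, of "{P}" "{Q}"]
    have "M.prob ((\<lambda>\<omega>. (X n \<omega>, \<omega> (n, P))) -` ({P} \<times> {Q})) = \<P>(\<omega> in M. X n \<omega> = P) * \<P>(\<omega> in M. \<omega> (n, P) = Q)"
      by (simp add: sp N_def vimage_def)
    then show ?thesis
      using coord[of "(n, P)" Q] by (simp add: sp vimage_def conj_commute)
  qed
  have "gsaw M adj C v0 X"
  proof (unfold_locales, goal_cases)
    case 1 then show ?case by (rule mX)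
  next
    case 2 then show ?case by (simp add: X0)
  next
    case (3 n P w)
    have "\<P>(\<omega> in M. X (Suc n) \<omega> = P @ [w] \<and> X n \<omega> = P) = \<P>(\<omega> in M. \<omega> (n, P) = P @ [w] \<and> X n \<omega> = P)"
      by (auto simp: XS intro!: arg_cong[where f=M.prob])
    then show ?case
      using 3 joint[of n P "P @ [w]"] pmf_g[of w P] by (simp add: cond_prob_def)
  next
    case (4 n)
    have "AE \<omega> in M. avail adj P = {} \<longrightarrow> \<omega> (n, P) = P" for P
    proof (cases "avail adj P = {}")
      case True
      then have "\<P>(\<omega> in M. \<omega> (n, P) = P) = 1"
        by (simp add: coord g_def)
      then show ?thesis
        using meas_coord[of "(n, P)"] by (subst (asm) M.prob_Collect_eq_1) auto
    qed auto
    then have "AE \<omega> in M. \<forall>P. avail adj P = {} \<longrightarrow> \<omega> (n, P) = P"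
      by (simp add: AE_all_countable)
    then show ?case
      by eventually_elim (auto simp: XS)
  qed
  then show ?thesis by blast
qed

lemma finite_ladder_adj: "finite {w. ladder_adj v w}"
proof (rule finite_subset)
  show "{w. ladder_adj v w} \<subseteq> {fst v - 1..fst v + 1} \<times> {1, 2}"
    by (auto simp: ladder_adj_def ladder_verts_def)
qed auto

corollary ladder_gsaw_exists:
  "C > 0 \<Longrightarrow> \<exists>(M :: (nat \<times> (int \<times> nat) list \<Rightarrow> (int \<times> nat) list) measure) X.
     gsaw M ladder_adj C v0 X"
  by (rule gsaw_exists[OF _ finite_ladder_adj])

end

theory Submission
  imports Defs
begin

text \<open>
  The walk on the ladder is a renewal process in disguise. At every time the visited region near the
  walker has one of a few shapes, here called phases, and the phase alone decides which steps are
  possible and with which probabilities (\<open>tracked_mean\<close>) and which phase comes next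
  (\<open>tracked_step\<close>). Once the walker has entered a fresh column next to a completely filled one
  (phase \<open>Front\<close>), everything behind is sealed off. From there it either fills the column and
  moves on to the next \<open>Front\<close>, or it runs ahead in one row and leaves a pocket of unvisited
  vertices in the other row. When it finally changes rows it either escapes into a fresh column,
  which is again a \<open>Front\<close>, or turns back into the pocket and dies at its end. The start of the
  walk is special because both sides are still open: a straight segment may be followed by a forced
  run back along its other side before the first \<open>Front\<close> is reached.

  Both quantities of interest are additive along the walk. A step costs 1 if it enters a fresh column
  and \<open>b\<close> otherwise, where \<open>b = 1\<close> counts the steps and \<open>b = 0\<close> gives the width. The first and
  second moments \<open>V\<close> and \<open>W\<close> of the cost still to come satisfy linear recursions over the phases.
  Since a step is forced or chosen with fixed probabilities while a segment or a pocket grows, the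
  solutions are affine, respectively quadratic, in the length of that segment or pocket, and the
  equation at \<open>Front\<close> then closes the system (\<open>V_recursion\<close>, \<open>W_recursion\<close>).

  To pass from recursions to expectations, let \<open>L\<close> be the cost so far. The recursions say that
  \<open>L + V\<close> and \<open>L\<^sup>2 + 2 L V + W\<close> are harmonic functions of the path, so their expectations stay
  constant in time, and at a terminal path they equal \<open>L\<close> and \<open>L\<^sup>2\<close>. For the step count, \<open>V\<close> and
  \<open>W\<close> are nonnegative, so the second function dominates the squared number of steps; Fatou's lemma
  gives almost sure termination and a finite second moment (\<open>AE_terminates\<close>). As all harmonic
  functions in use grow at most quadratically with the length of the path, dominated convergence
  then yields optional stopping at the terminal time (\<open>optional_stopping\<close>).
\<close>

section \<open>Harmonic functions and optional stopping\<close>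

inductive grown :: "('v \<Rightarrow> 'v \<Rightarrow> bool) \<Rightarrow> 'v \<Rightarrow> 'v list \<Rightarrow> bool" for adj v0 where
  grown_start: "grown adj v0 [v0]"
| grown_step: "grown adj v0 P \<Longrightarrow> w \<in> avail adj P \<Longrightarrow> grown adj v0 (P @ [w])"

text \<open>
  Harmonicity is required only on paths that the walk can produce, and only before termination: a
  terminated walk stays where it is.
\<close>
definition harmonic :: "('v \<Rightarrow> 'v \<Rightarrow> bool) \<Rightarrow> real \<Rightarrow> 'v \<Rightarrow> ('v list \<Rightarrow> real) \<Rightarrow> bool" where
  "harmonic adj C v0 f \<longleftrightarrow> (\<forall>P. grown adj v0 P \<longrightarrow> avail adj P \<noteq> {} \<longrightarrow>
     f P = (\<Sum>w\<in>avail adj P. gsaw_prob adj C P w * f (P @ [w])))"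

locale locally_finite_gsaw = gsaw M adj C v0 X
  for M :: "'w measure" and adj :: "'v \<Rightarrow> 'v \<Rightarrow> bool" and C v0 X +
  assumes C_pos: "C > 0" and finite_nbrs: "finite {w. adj v w}"
begin

lemma finite_avail: "finite (avail adj P)"
  by (rule finite_subset[OF _ finite_nbrs[of "last P"]]) (auto simp: avail_def)

lemma sum_gsaw_prob:
  assumes "avail adj P \<noteq> {}"
  shows "(\<Sum>w\<in>avail adj P. gsaw_prob adj C P w) = 1"
proof -
  have "(\<Sum>w\<in>avail adj P. energy adj C P w) > 0"
    using assms finite_avail C_pos by (intro sum_pos) (auto simp: energy_def)
  then show ?thesis
    by (simp add: gsaw_prob_def flip: sum_divide_distrib)
qed

text \<open>
  As the graph is locally finite, at each time the walk is confined to a finite set of paths.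
  Expectations over a fixed time are therefore finite sums and raise no question of integrability.
\<close>
fun possible_paths :: "nat \<Rightarrow> 'v list set" where
  "possible_paths 0 = {[v0]}"
| "possible_paths (Suc n) = possible_paths n \<union>
     (\<Union>P\<in>possible_paths n. (\<lambda>w. P @ [w]) ` avail adj P)"

lemma finite_possible_paths: "finite (possible_paths n)"
  by (induction n) (auto simp: finite_avail)

lemma grown_possible_paths: "P \<in> possible_paths n \<Longrightarrow> grown adj v0 P"
  by (induction n arbitrary: P) (auto intro: grown.intros)

lemma measurable_X_pred [measurable]: "Measurable.pred M (\<lambda>\<omega>. Q (X n \<omega>))"
  by (rule measurable_compose[OF random_path]) auto

lemma borel_measurable_X: "(\<lambda>\<omega>. f (X n \<omega>)) \<in> borel_measurable M"
  by (rule measurable_compose[OF random_path]) auto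

text \<open>
  Stated without conditioning, the transition law also covers paths of probability zero.
\<close>
lemma prob_extend:
  assumes "w \<in> avail adj P"
  shows "\<P>(\<omega> in M. X (Suc n) \<omega> = P @ [w] \<and> X n \<omega> = P)
    = \<P>(\<omega> in M. X n \<omega> = P) * gsaw_prob adj C P w"
proof (cases "\<P>(\<omega> in M. X n \<omega> = P) > 0")
  case True
  with step[OF True assms] show ?thesis
    by (simp add: cond_prob_def field_simps)
next
  case False
  then have 0: "\<P>(\<omega> in M. X n \<omega> = P) = 0"
    by (metis measure_nonneg order_le_less)
  have "\<P>(\<omega> in M. X (Suc n) \<omega> = P @ [w] \<and> X n \<omega> = P) \<le> \<P>(\<omega> in M. X n \<omega> = P)"
    by (intro finite_measure_mono) auto
  with 0 show ?thesis by (simp add: measure_le_0_iff)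
qed

text \<open>
  The transition probabilities out of \<open>P\<close> sum to 1, so the one-step extensions exhaust the
  event that the walk is at \<open>P\<close>.
\<close>
lemma AE_extend_at:
  assumes "avail adj P \<noteq> {}"
  shows "AE \<omega> in M. X n \<omega> = P \<longrightarrow> (\<exists>w\<in>avail adj P. X (Suc n) \<omega> = P @ [w])"
proof -
  let ?A = "{\<omega> \<in> space M. X n \<omega> = P}"
  let ?B = "\<lambda>w. {\<omega> \<in> space M. X (Suc n) \<omega> = P @ [w] \<and> X n \<omega> = P}"
  let ?U = "\<Union>w\<in>avail adj P. ?B w"
  have B [measurable]: "?B w \<in> sets M" for w by measurable
  have U: "?U \<in> sets M" using finite_avail by (intro sets.finite_UN) auto
  have "prob ?U = (\<Sum>w\<in>avail adj P. prob (?B w))"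
    using finite_avail
    by (intro finite_measure_finite_Union) (auto simp: disjoint_family_on_def)
  also have "\<dots> = prob ?A"
    by (simp add: prob_extend sum_gsaw_prob[OF assms] flip: sum_distrib_left)
  finally have "prob (?A - ?U) = 0"
    using U by (subst finite_measure_Diff) auto
  then have "AE \<omega> in M. \<omega> \<notin> ?A - ?U"
    using U by (intro AE_not_in) (auto simp: null_sets_def emeasure_eq_measure)
  then show ?thesis
    by (rule AE_mp) (auto intro!: AE_I2)
qed

lemma AE_possible_paths: "AE \<omega> in M. X n \<omega> \<in> possible_paths n"
proof (induction n)
  case 0
  show ?case using start by auto
next
  case (Suc n)
  have "AE \<omega> in M. \<forall>P\<in>possible_paths n. avail adj P \<noteq> {} \<longrightarrow>
      X n \<omega> = P \<longrightarrow> (\<exists>w\<in>avail adj P. X (Suc n) \<omega> = P @ [w])"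
    using AE_extend_at by (intro AE_finite_allI finite_possible_paths) auto
  with Suc stop[of n] show ?case
  proof eventually_elim
    case (elim \<omega>)
    show ?case
    proof (cases "avail adj (X n \<omega>) = {}")
      case False
      with elim obtain w where "w \<in> avail adj (X n \<omega>)" "X (Suc n) \<omega> = X n \<omega> @ [w]" by blast
      with elim(1) show ?thesis by auto
    qed (use elim in auto)
  qed
qed

lemma AE_extend:
  "AE \<omega> in M. avail adj (X n \<omega>) \<noteq> {} \<longrightarrow> (\<exists>w\<in>avail adj (X n \<omega>). X (Suc n) \<omega> = X n \<omega> @ [w])"
proof -
  have "AE \<omega> in M. \<forall>P\<in>possible_paths n. avail adj P \<noteq> {} \<longrightarrow>
      X n \<omega> = P \<longrightarrow> (\<exists>w\<in>avail adj P. X (Suc n) \<omega> = P @ [w])"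
    using AE_extend_at by (intro AE_finite_allI finite_possible_paths) auto
  with AE_possible_paths[of n] show ?thesis
    by eventually_elim auto
qed

lemma integrable_X: "integrable M (\<lambda>\<omega>. f (X n \<omega>) :: real)"
proof (rule integrable_const_bound[where B = "Max ((\<lambda>P. \<bar>f P\<bar>) ` possible_paths n)"])
  show "AE \<omega> in M. norm (f (X n \<omega>)) \<le> Max ((\<lambda>P. \<bar>f P\<bar>) ` possible_paths n)"
    using AE_possible_paths[of n]
    by eventually_elim (auto intro!: Max_ge finite_possible_paths)
qed (rule borel_measurable_X)

lemma joint_measurable:
  "(\<lambda>\<omega>. g (X k \<omega>) * indicator {P} (X n \<omega>) :: real) \<in> borel_measurable M"
  by (intro borel_measurable_times borel_measurable_X)

lemma expectation_split:
  fixes f :: "'v list \<Rightarrow> real"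
  shows "expectation (\<lambda>\<omega>. f (X k \<omega>)) =
    (\<Sum>P\<in>possible_paths n. expectation (\<lambda>\<omega>. f (X k \<omega>) * indicator {P} (X n \<omega>)))"
proof -
  have int: "integrable M (\<lambda>\<omega>. f (X k \<omega>) * indicator {P} (X n \<omega>))" for P
    using integrable_X[of f k]
    by (rule Bochner_Integration.integrable_bound)
       (auto simp: abs_mult split: split_indicator intro!: joint_measurable simp del: indicator_simps)
  have "expectation (\<lambda>\<omega>. f (X k \<omega>)) = expectation (\<lambda>\<omega>. \<Sum>P\<in>possible_paths n. f (X k \<omega>) * indicator {P} (X n \<omega>))"
  proof (rule integral_cong_AE)
    show "AE \<omega> in M. f (X k \<omega>) = (\<Sum>P\<in>possible_paths n. f (X k \<omega>) * indicator {P} (X n \<omega>))"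
      using AE_possible_paths[of n]
      by eventually_elim (simp add: indicator_def finite_possible_paths flip: sum_distrib_left)
  qed (use int in \<open>auto intro!: borel_measurable_X borel_measurable_sum dest: borel_measurable_integrable\<close>)
  also have "\<dots> = (\<Sum>P\<in>possible_paths n. expectation (\<lambda>\<omega>. f (X k \<omega>) * indicator {P} (X n \<omega>)))"
    using int by (rule Bochner_Integration.integral_sum)
  finally show ?thesis .
qed

lemma expectation_at:
  "expectation (\<lambda>\<omega>. f (X n \<omega>) * indicator {P} (X n \<omega>)) = f P * \<P>(\<omega> in M. X n \<omega> = P)"
proof -
  have "expectation (\<lambda>\<omega>. f (X n \<omega>) * indicator {P} (X n \<omega>))
      = expectation (\<lambda>\<omega>. f P * indicator {\<omega> \<in> space M. X n \<omega> = P} \<omega>)"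
    by (intro Bochner_Integration.integral_cong) (auto simp: indicator_def)
  then show ?thesis by simp
qed

lemma expectation_next_at:
  assumes "harmonic adj C v0 f" "grown adj v0 P"
  shows "expectation (\<lambda>\<omega>. f (X (Suc n) \<omega>) * indicator {P} (X n \<omega>))
    = f P * \<P>(\<omega> in M. X n \<omega> = P)"
proof (cases "avail adj P = {}")
  case True
  have "expectation (\<lambda>\<omega>. f (X (Suc n) \<omega>) * indicator {P} (X n \<omega>))
      = expectation (\<lambda>\<omega>. f (X n \<omega>) * indicator {P} (X n \<omega>))"
    proof (rule integral_cong_AE)
    show "AE \<omega> in M. f (X (Suc n) \<omega>) * indicator {P} (X n \<omega>) = f (X n \<omega>) * indicator {P} (X n \<omega>)"
      using stop[of n] by eventually_elim (auto simp: True indicator_def)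
  qed (rule joint_measurable)+
  then show ?thesis by (simp add: expectation_at)
next
  case False
  let ?B = "\<lambda>w. {\<omega> \<in> space M. X (Suc n) \<omega> = P @ [w] \<and> X n \<omega> = P}"
  have B [measurable]: "?B w \<in> sets M" for w by measurable
  have "expectation (\<lambda>\<omega>. f (X (Suc n) \<omega>) * indicator {P} (X n \<omega>))
      = expectation (\<lambda>\<omega>. \<Sum>w\<in>avail adj P. f (P @ [w]) * indicator (?B w) \<omega>)"
  proof (rule integral_cong_AE)
    show "AE \<omega> in M. f (X (Suc n) \<omega>) * indicator {P} (X n \<omega>)
        = (\<Sum>w\<in>avail adj P. f (P @ [w]) * indicator (?B w) \<omega>)"
      using AE_extend_at[OF False, of n] AE_space
    proof eventually_elim
      case (elim \<omega>)
      show ?case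
      proof (cases "X n \<omega> = P")
        case True
        with elim obtain w where "w \<in> avail adj P" "X (Suc n) \<omega> = P @ [w]" by auto
        with True elim show ?thesis
          by (simp add: indicator_def finite_avail if_distrib[where f="\<lambda>x. _ * x"] sum.delta cong: if_cong)
      qed simp
    qed
  qed (auto intro!: joint_measurable)
  also have "\<dots> = (\<Sum>w\<in>avail adj P. f (P @ [w]) * prob (?B w))"
    by (subst Bochner_Integration.integral_sum) (auto simp: emeasure_eq_measure)
  also have "\<dots> = \<P>(\<omega> in M. X n \<omega> = P) * (\<Sum>w\<in>avail adj P. gsaw_prob adj C P w * f (P @ [w]))"
    by (simp add: prob_extend sum_distrib_left mult_ac)
  also have "\<dots> = f P * \<P>(\<omega> in M. X n \<omega> = P)"
    using assms False unfolding harmonic_def by simp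
  finally show ?thesis .
qed

text \<open>
  Conditioning on the path at time \<open>n\<close> reproduces the harmonic equation, one summand at a time.
\<close>
lemma expectation_harmonic:
  assumes "harmonic adj C v0 f"
  shows "expectation (\<lambda>\<omega>. f (X n \<omega>)) = f [v0]"
proof (induction n)
  case 0
  have "expectation (\<lambda>\<omega>. f (X 0 \<omega>)) = expectation (\<lambda>_. f [v0])"
    using start by (intro integral_cong_AE borel_measurable_X) auto
  then show ?case by (simp add: prob_space)
next
  case (Suc n)
  have "expectation (\<lambda>\<omega>. f (X (Suc n) \<omega>)) = expectation (\<lambda>\<omega>. f (X n \<omega>))"
    unfolding expectation_split[of f _ n]
    by (intro sum.cong) (simp_all add: expectation_next_at[OF assms grown_possible_paths] expectation_at)
  with Suc show ?case by simp
qed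

text \<open>
  The outcomes on which the walk obeys its transition rules at every time. Pathwise arguments take
  place on this almost sure event.
\<close>
definition regular :: "'w \<Rightarrow> bool" where
  "regular \<omega> \<longleftrightarrow> X 0 \<omega> = [v0] \<and> (\<forall>n. if avail adj (X n \<omega>) = {} then X (Suc n) \<omega> = X n \<omega>
     else \<exists>w\<in>avail adj (X n \<omega>). X (Suc n) \<omega> = X n \<omega> @ [w])"

lemma AE_regular: "AE \<omega> in M. regular \<omega>"
proof -
  have "AE \<omega> in M. \<forall>n. if avail adj (X n \<omega>) = {} then X (Suc n) \<omega> = X n \<omega>
     else \<exists>w\<in>avail adj (X n \<omega>). X (Suc n) \<omega> = X n \<omega> @ [w]"
    unfolding AE_all_countable
  proof
    fix n
    show "AE \<omega> in M. if avail adj (X n \<omega>) = {} then X (Suc n) \<omega> = X n \<omega>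
       else \<exists>w\<in>avail adj (X n \<omega>). X (Suc n) \<omega> = X n \<omega> @ [w]"
      using stop[of n] AE_extend[of n] by eventually_elim simp
  qed
  with start show ?thesis
    unfolding regular_def by eventually_elim simp
qed

lemma regular_grown:
  assumes "regular \<omega>"
  shows "grown adj v0 (X n \<omega>)"
proof (induction n)
  case 0
  show ?case using assms by (simp add: regular_def grown.intros)
next
  case (Suc n)
  then show ?case using assms unfolding regular_def
    by (metis grown_step)
qed

lemma regular_length:
  assumes "regular \<omega>" "\<And>i. i < n \<Longrightarrow> avail adj (X i \<omega>) \<noteq> {}"
  shows "length (X n \<omega>) = Suc n"
  using assms(2)
proof (induction n)
  case 0
  show ?case using assms by (simp add: regular_def)
next
  case (Suc n)
  from Suc.prems[of n] assms(1) obtain w where "X (Suc n) \<omega> = X n \<omega> @ [w]"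
    unfolding regular_def by (metis lessI)
  with Suc show ?case by simp
qed

abbreviation steps :: "'w \<Rightarrow> nat" where "steps \<equiv> num_steps adj X"
abbreviation final :: "'w \<Rightarrow> 'v list" where "final \<omega> \<equiv> X (steps \<omega>) \<omega>"

lemma avail_final: "\<exists>n. avail adj (X n \<omega>) = {} \<Longrightarrow> avail adj (final \<omega>) = {}"
  unfolding num_steps_def by (rule LeastI_ex)

lemma not_stuck_before: "i < steps \<omega> \<Longrightarrow> avail adj (X i \<omega>) \<noteq> {}"
  unfolding num_steps_def by (rule not_less_Least)

lemma length_final:
  assumes "regular \<omega>"
  shows "length (final \<omega>) = Suc (steps \<omega>)"
  by (rule regular_length[OF assms not_stuck_before])

lemma after_final:
  assumes "regular \<omega>" "\<exists>n. avail adj (X n \<omega>) = {}" "n \<ge> steps \<omega>"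
  shows "X n \<omega> = final \<omega>"
  using assms(3)
proof (induction n rule: dec_induct)
  case (step n)
  then show ?case using assms(1) avail_final[OF assms(2)] unfolding regular_def by metis
qed simp

lemma length_le_final:
  assumes "regular \<omega>" "\<exists>n. avail adj (X n \<omega>) = {}"
  shows "length (X n \<omega>) \<le> Suc (steps \<omega>)"
proof (cases "n \<ge> steps \<omega>")
  case True
  then show ?thesis using after_final[OF assms, of n] length_final[OF assms(1)] by (metis order_refl)
next
  case False
  then have "length (X n \<omega>) = Suc n"
    by (intro regular_length[OF assms(1)]) (use False not_stuck_before in auto)
  with False show ?thesis by simp
qed

lemma measurable_steps [measurable]: "steps \<in> measurable M (count_space UNIV)"
  unfolding num_steps_def[abs_def] by (rule measurable_Least) measurable

lemma measurable_final: "final \<in> measurable M (count_space UNIV)"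
  by (rule measurable_compose_countable[OF random_path measurable_steps])

lemma borel_measurable_final: "(\<lambda>\<omega>. f (final \<omega>)) \<in> borel_measurable M"
  by (rule measurable_compose[OF measurable_final]) auto

text \<open>
  A walk that has not terminated after \<open>n\<close> steps has length exactly \<open>n + 1\<close>, so on an outcome
  without termination the squared step counts diverge. Their expectations are bounded by the
  conserved value \<open>f [v0]\<close>, hence by Fatou's lemma their limit inferior is integrable, and thus
  finite almost everywhere. On terminating outcomes that limit inferior is the squared total number
  of steps.
\<close>
lemma AE_terminates:
  assumes harm: "harmonic adj C v0 f"
    and ge: "\<And>P. grown adj v0 P \<Longrightarrow> (real (length P) - 1)\<^sup>2 \<le> f P"
  shows "AE \<omega> in M. \<exists>n. avail adj (X n \<omega>) = {}"
    and "integrable M (\<lambda>\<omega>. (real (steps \<omega>))\<^sup>2)"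
proof -
  define u where "u = (\<lambda>n \<omega>. ennreal ((real (length (X n \<omega>)) - 1)\<^sup>2))"
  have m [measurable]: "u n \<in> borel_measurable M" for n
    unfolding u_def
    by (rule measurable_compose[OF borel_measurable_X[of "\<lambda>P. (real (length P) - 1)\<^sup>2"] measurable_ennreal])
  have le: "(\<integral>\<^sup>+\<omega>. u n \<omega> \<partial>M) \<le> ennreal (f [v0])" for n
  proof -
    have "(\<integral>\<^sup>+\<omega>. u n \<omega> \<partial>M) = ennreal (expectation (\<lambda>\<omega>. (real (length (X n \<omega>)) - 1)\<^sup>2))"
      unfolding u_def
      by (rule nn_integral_eq_integral[OF integrable_X[where f="\<lambda>P. (real (length P) - 1)\<^sup>2"]]) auto
    also have "\<dots> \<le> ennreal (expectation (\<lambda>\<omega>. f (X n \<omega>)))"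
    proof (intro ennreal_leI integral_mono_AE integrable_X[where f="\<lambda>P. (real (length P) - 1)\<^sup>2"] integrable_X[where f=f])
      show "AE \<omega> in M. (real (length (X n \<omega>)) - 1)\<^sup>2 \<le> f (X n \<omega>)"
        using AE_possible_paths[of n] by eventually_elim (intro ge grown_possible_paths)
    qed
    also have "\<dots> = ennreal (f [v0])" by (simp add: expectation_harmonic[OF harm])
    finally show ?thesis .
  qed
  have "(\<integral>\<^sup>+\<omega>. liminf (\<lambda>n. u n \<omega>) \<partial>M) \<le> liminf (\<lambda>n. \<integral>\<^sup>+\<omega>. u n \<omega> \<partial>M)"
    by (rule nn_integral_liminf) (rule m)
  also have "\<dots> \<le> liminf (\<lambda>n::nat. ennreal (f [v0]))"
    by (intro Liminf_mono always_eventually allI le)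
  also have "\<dots> = ennreal (f [v0])" by (simp add: Liminf_const)
  finally have fin: "(\<integral>\<^sup>+\<omega>. liminf (\<lambda>n. u n \<omega>) \<partial>M) < \<infinity>"
    using ennreal_less_top le_less_trans by (metis infinity_ennreal_def)
  have "AE \<omega> in M. liminf (\<lambda>n. u n \<omega>) \<noteq> \<infinity>"
    using fin by (intro nn_integral_PInf_AE) auto
  then show ends: "AE \<omega> in M. \<exists>n. avail adj (X n \<omega>) = {}"
    using AE_regular
  proof eventually_elim
    case (elim \<omega>)
    show ?case
    proof (rule ccontr)
      assume "\<not> ?case"
      then have "u n \<omega> = ennreal ((real n)\<^sup>2)" for n
        using regular_length[OF elim(2), of n] by (simp add: u_def)
      moreover have "(\<lambda>n. ennreal ((real n)\<^sup>2)) \<longlonglongrightarrow> top"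
        unfolding ennreal_tendsto_top_eq_at_top
        by (intro filterlim_pow_at_top filterlim_real_sequentially) auto
      ultimately show False using elim(1) by (simp add: lim_imp_Liminf)
    qed
  qed
  have "(\<integral>\<^sup>+\<omega>. ennreal ((real (steps \<omega>))\<^sup>2) \<partial>M) = (\<integral>\<^sup>+\<omega>. liminf (\<lambda>n. u n \<omega>) \<partial>M)"
  proof (rule nn_integral_cong_AE)
    show "AE \<omega> in M. ennreal ((real (steps \<omega>))\<^sup>2) = liminf (\<lambda>n. u n \<omega>)"
      using ends AE_regular
    proof eventually_elim
      case (elim \<omega>)
      have "eventually (\<lambda>n. u n \<omega> = ennreal ((real (steps \<omega>))\<^sup>2)) sequentially"
        using eventually_ge_at_top[of "steps \<omega>"]
        by eventually_elim (use after_final[OF elim(2,1)] length_final[OF elim(2)] in \<open>metis u_def add_diff_cancel_left' of_nat_Suc\<close>)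
      then have "(\<lambda>n. u n \<omega>) \<longlonglongrightarrow> ennreal ((real (steps \<omega>))\<^sup>2)"
        by (rule tendsto_eventually)
      then show ?case by (simp add: lim_imp_Liminf)
    qed
  qed
  with fin show "integrable M (\<lambda>\<omega>. (real (steps \<omega>))\<^sup>2)"
    by (intro integrableI_nonneg) auto
qed

text \<open>
  No path ever gets longer than the final one. A function of quadratic growth is therefore
  dominated along the whole walk by a multiple of the squared number of steps.
\<close>
lemma optional_stopping:
  assumes harm: "harmonic adj C v0 f"
    and ends: "AE \<omega> in M. \<exists>n. avail adj (X n \<omega>) = {}"
    and int: "integrable M (\<lambda>\<omega>. (real (steps \<omega>))\<^sup>2)"
    and bound: "\<And>P. grown adj v0 P \<Longrightarrow> \<bar>f P\<bar> \<le> K * (real (length P))\<^sup>2"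
  shows "integrable M (\<lambda>\<omega>. f (final \<omega>))" and "expectation (\<lambda>\<omega>. f (final \<omega>)) = f [v0]"
proof -
  have "K * 1 \<ge> 0" using bound[OF grown_start] by (simp; linarith)
  then have K: "K \<ge> 0" by simp
  have lim: "AE \<omega> in M. (\<lambda>n. f (X n \<omega>)) \<longlonglongrightarrow> f (final \<omega>)"
    using ends AE_regular
  proof eventually_elim
    case (elim \<omega>)
    have "eventually (\<lambda>n. f (X n \<omega>) = f (final \<omega>)) sequentially"
      using eventually_ge_at_top[of "steps \<omega>"]
      by eventually_elim (use after_final[OF elim(2,1)] in metis)
    then show ?case by (rule tendsto_eventually)
  qed
  \<comment> \<open>The bound \<open>(n + 1)\<^sup>2 \<le> 2 * n\<^sup>2 + 2\<close> makes the dominating function integrable.\<close>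
  have dom: "AE \<omega> in M. norm (f (X n \<omega>)) \<le> K * (2 * (real (steps \<omega>))\<^sup>2 + 2)" for n
    using ends AE_regular
  proof eventually_elim
    case (elim \<omega>)
    have "\<bar>f (X n \<omega>)\<bar> \<le> K * (real (length (X n \<omega>)))\<^sup>2"
      by (intro bound regular_grown elim)
    also have "\<dots> \<le> K * (real (steps \<omega>) + 1)\<^sup>2"
      using length_le_final[OF elim(2,1), of n] K
      by (intro mult_left_mono power_mono) auto
    also have "(real (steps \<omega>) + 1)\<^sup>2 \<le> 2 * (real (steps \<omega>))\<^sup>2 + 2"
      using sum_squares_ge_zero[of "real (steps \<omega>) - 1" 0] by (simp add: power2_eq_square algebra_simps)
    finally show ?case using K by (simp add: mult_left_mono)
  qed
  have w: "integrable M (\<lambda>\<omega>. K * (2 * (real (steps \<omega>))\<^sup>2 + 2))"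
    using int by auto
  show "integrable M (\<lambda>\<omega>. f (final \<omega>))"
    by (rule integrable_dominated_convergence[OF borel_measurable_final borel_measurable_X w lim dom])
  have "(\<lambda>n. expectation (\<lambda>\<omega>. f (X n \<omega>))) \<longlonglongrightarrow> expectation (\<lambda>\<omega>. f (final \<omega>))"
    by (rule integral_dominated_convergence[OF borel_measurable_final borel_measurable_X w lim dom])
  then show "expectation (\<lambda>\<omega>. f (final \<omega>)) = f [v0]"
    by (simp add: expectation_harmonic[OF harm] LIMSEQ_const_iff)
qed

end

section \<open>Phases of the walk on the ladder\<close>

text \<open>
  The steps are classified by the column they lead to: the other vertex of the current column, a
  column without visited vertices, or a neighbouring column that has been visited before.
\<close>
datatype move = Across | Fresh | Back

text \<open>
  \<^item> \<open>Straight r\<close>: the path is a horizontal segment with \<open>r\<close> edges.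
  \<^item> \<open>Turn r\<close>: it is such a segment followed by one step across.
  \<^item> \<open>Return j\<close>: the walker is on its way along the unvisited side of a visited strip, with \<open>j\<close> more
    columns to pass before it enters a fresh one. In particular, \<open>Return 0\<close> arises whenever it has
    just filled a column next to a filled one.
  \<^item> \<open>Front\<close>: it has entered a fresh column next to a filled one.
  \<^item> \<open>Gap m\<close>: it has passed in one row along \<open>m\<close> vertices of the other row that are unvisited and
    form a pocket closed at the far end.
  \<^item> \<open>Fork m\<close>: it has just changed rows and stands at the mouth of a pocket with \<open>m\<close> vertices.
  \<^item> \<open>Trapped j\<close>: it is inside the pocket with \<open>j\<close> vertices left to visit.
\<close>
datatype phase = Straight nat | Turn nat | Return nat | Front | Gap nat | Fork nat | Trapped nat

definition move_kind :: "(int \<times> nat) list \<Rightarrow> int \<times> nat \<Rightarrow> move" where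
  "move_kind P w = (if fst w = fst (last P) then Across
     else if fst w \<in> fst ` set P then Back else Fresh)"

text \<open>
  A backward move from \<open>Turn r\<close> or into a pocket of \<open>m\<close> vertices already covers one column, whence
  the decrements.
\<close>
fun next_phase :: "phase \<Rightarrow> move \<Rightarrow> phase" where
  "next_phase (Straight r) k = (if k = Across then Turn r else Straight (Suc r))"
| "next_phase (Turn r) k = (if k = Back then Return (r - 1) else Front)"
| "next_phase (Return j) k = (if k = Back then Return (j - 1) else Front)"
| "next_phase Front k = (if k = Across then Return 0 else Gap 1)"
| "next_phase (Gap m) k = (if k = Across then Fork m else Gap (Suc m))"
| "next_phase (Fork m) k = (if k = Back then Trapped (m - 1) else Front)"
| "next_phase (Trapped j) k = Trapped (j - 1)"

fun rev_phase :: "(int \<times> nat) list \<Rightarrow> phase" where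
  "rev_phase [] = Straight 0"
| "rev_phase [v] = Straight 0"
| "rev_phase (w # v # Q) = next_phase (rev_phase (v # Q)) (move_kind (rev (v # Q)) w)"

definition phase :: "(int \<times> nat) list \<Rightarrow> phase" where
  "phase P = rev_phase (rev P)"

lemma phase_single: "phase [v] = Straight 0"
  by (simp add: phase_def)

lemma phase_snoc:
  assumes "P \<noteq> []"
  shows "phase (P @ [w]) = next_phase (phase P) (move_kind P w)"
proof -
  from assms obtain v Q where "rev P = v # Q"
    by (metis list.exhaust rev_is_Nil_conv)
  then show ?thesis
    by (simp add: phase_def)
qed

text \<open>
  The mean of \<open>\<phi>\<close> over the next move. Where there is a choice, a move back to a visited column, or
  across next to a filled one, leads to a vertex with one visited neighbour besides the walker's
  position and so has weight \<open>C\<close>; all other candidates have weight 1. The only exception is a pocket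
  with a single vertex: this vertex also touches the closed end of the pocket, which gives the weight
  \<open>C\<^sup>2\<close>. At the very start, two of the three candidates lie in fresh columns.
\<close>
fun mean_next :: "real \<Rightarrow> phase \<Rightarrow> (move \<Rightarrow> real) \<Rightarrow> real" where
  "mean_next C (Straight r) \<phi> =
     (if r = 0 then (\<phi> Across + 2 * \<phi> Fresh) / 3 else (\<phi> Across + \<phi> Fresh) / 2)"
| "mean_next C (Turn r) \<phi> = (if r = 0 then \<phi> Fresh else (C * \<phi> Back + \<phi> Fresh) / (1 + C))"
| "mean_next C (Return j) \<phi> = (if j = 0 then \<phi> Fresh else \<phi> Back)"
| "mean_next C Front \<phi> = (C * \<phi> Across + \<phi> Fresh) / (1 + C)"
| "mean_next C (Gap m) \<phi> = (\<phi> Across + \<phi> Fresh) / 2"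
| "mean_next C (Fork m) \<phi> =
     (if m = 1 then (C\<^sup>2 * \<phi> Back + \<phi> Fresh) / (1 + C\<^sup>2) else (C * \<phi> Back + \<phi> Fresh) / (1 + C))"
| "mean_next C (Trapped j) \<phi> = \<phi> Back"

text \<open>
  The shape of the visited set as seen by the walker: \<open>A i\<close> and \<open>B i\<close> tell whether the vertex \<open>i\<close>
  columns ahead (behind, for negative \<open>i\<close>) is visited in the walker's own row and in the other row.
  Only what later steps can still see is recorded.
\<close>
fun shape :: "phase \<Rightarrow> (int \<Rightarrow> bool) \<Rightarrow> (int \<Rightarrow> bool) \<Rightarrow> bool" where
  "shape (Straight r) A B \<longleftrightarrow> (\<forall>i. A i \<longleftrightarrow> - int r \<le> i \<and> i \<le> 0) \<and> (\<forall>i. \<not> B i)"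
| "shape (Turn r) A B \<longleftrightarrow> (\<forall>i. A i \<longleftrightarrow> i = 0) \<and> (\<forall>i. B i \<longleftrightarrow> - int r \<le> i \<and> i \<le> 0)"
| "shape (Return j) A B \<longleftrightarrow> A (-1) \<and> (\<forall>i>0. \<not> A i) \<and> (\<forall>i\<ge>0. B i \<longleftrightarrow> i \<le> int j)"
| "shape Front A B \<longleftrightarrow> A (-1) \<and> B (-1) \<and> (\<forall>i>0. \<not> A i) \<and> (\<forall>i\<ge>0. \<not> B i)"
| "shape (Gap m) A B \<longleftrightarrow> m > 0 \<and> (\<forall>i. - int m \<le> i \<and> i \<le> 0 \<longrightarrow> A i \<and> \<not> B i) \<and>
     B (- int m - 1) \<and> (\<forall>i>0. \<not> A i \<and> \<not> B i)"
| "shape (Fork m) A B \<longleftrightarrow> m > 0 \<and> (\<forall>i. - int m \<le> i \<and> i \<le> 0 \<longrightarrow> B i) \<and>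
     (\<forall>i. - int m \<le> i \<and> i < 0 \<longrightarrow> \<not> A i) \<and> A (- int m - 1) \<and> (\<forall>i>0. \<not> A i \<and> \<not> B i)"
| "shape (Trapped j) A B \<longleftrightarrow> A (-1) \<and> A (int j + 1) \<and>
     (\<forall>i. 0 < i \<and> i \<le> int j \<longrightarrow> \<not> A i) \<and> (\<forall>i. 0 \<le> i \<and> i \<le> int j \<longrightarrow> B i)"

text \<open>
  Each neighbour of the walker has two neighbours besides the walker's position; \<open>p\<close> and \<open>q\<close> tell
  whether these are visited. Giving visited candidates weight 0 lets all three directions enter the
  sums.
\<close>
definition weight :: "real \<Rightarrow> bool \<Rightarrow> bool \<Rightarrow> bool \<Rightarrow> real" where
  "weight C visited p q = (if visited then 0 else C ^ (of_bool p + of_bool q))"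

abbreviation ahead :: "real \<Rightarrow> (int \<Rightarrow> bool) \<Rightarrow> (int \<Rightarrow> bool) \<Rightarrow> real" where
  "ahead C A B \<equiv> weight C (A 1) (A 2) (B 1)"
abbreviation behind :: "real \<Rightarrow> (int \<Rightarrow> bool) \<Rightarrow> (int \<Rightarrow> bool) \<Rightarrow> real" where
  "behind C A B \<equiv> weight C (A (-1)) (A (-2)) (B (-1))"
abbreviation across :: "real \<Rightarrow> (int \<Rightarrow> bool) \<Rightarrow> (int \<Rightarrow> bool) \<Rightarrow> real" where
  "across C A B \<equiv> weight C (B 0) (B 1) (B (-1))"

abbreviation entered :: "(int \<Rightarrow> bool) \<Rightarrow> int \<Rightarrow> move" where
  "entered B i \<equiv> (if B i then Back else Fresh)"

text \<open>
  Weights reach only two columns away, and the shape determines every vertex that affects them.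
\<close>
lemma shape_mean:
  assumes "C > 0" "shape s A B" "s \<noteq> Trapped 0"
  shows "(ahead C A B * \<phi> (entered B 1) + behind C A B * \<phi> (entered B (-1)) + across C A B * \<phi> Across)
      / (ahead C A B + behind C A B + across C A B) = mean_next C s \<phi>"
proof (cases s)
  case (Straight r)
  then show ?thesis using assms by (cases "r = 0") (auto simp: weight_def field_simps)
next
  case (Turn r)
  then show ?thesis using assms by (cases "r = 0") (auto simp: weight_def field_simps)
next
  case (Return j)
  then show ?thesis using assms by (cases "j = 0") (auto simp: weight_def field_simps)
next
  case Front
  then show ?thesis using assms by (auto simp: weight_def field_simps)
next
  case (Gap m)
  then show ?thesis using assms by (auto simp: weight_def field_simps)
next
  case (Fork m)
  then show ?thesis using assms
    by (cases "m = 1") (auto simp: weight_def field_simps power2_eq_square)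
next
  case (Trapped j)
  then show ?thesis using assms by (auto simp: weight_def field_simps)
qed

lemma shape_stuck: "shape (Trapped 0) A B \<Longrightarrow> A 1 \<and> A (-1) \<and> B 0"
  by simp

lemma shape_not_stuck: "shape s A B \<Longrightarrow> s \<noteq> Trapped 0 \<Longrightarrow> \<not> (A 1 \<and> A (-1) \<and> B 0)"
  by (cases s) auto

text \<open>
  Left and right play symmetric roles, so a phase is matched in one of the two orientations.
\<close>
definition facing :: "phase \<Rightarrow> (int \<Rightarrow> bool) \<Rightarrow> (int \<Rightarrow> bool) \<Rightarrow> bool" where
  "facing s A B \<longleftrightarrow> shape s A B \<or> shape s (\<lambda>i. A (-i)) (\<lambda>i. B (-i))"

lemma facing_flip: "facing s (\<lambda>i. A (-i)) (\<lambda>i. B (-i)) \<longleftrightarrow> facing s A B"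
  by (auto simp: facing_def)

text \<open>
  A step moves the frame of reference along with the walker. The next phase may be seen in the
  opposite orientation, for instance after the walker has turned back.
\<close>
lemma shape_ahead:
  assumes "shape s A B" "A 0" "\<not> A 1"
  shows "facing (next_phase s (entered B 1)) (\<lambda>i. i = 0 \<or> A (i + 1)) (\<lambda>i. B (i + 1))"
proof (cases s)
  case (Straight r)
  then show ?thesis using assms by (auto simp: facing_def)
next
  case (Turn r)
  then show ?thesis using assms by (auto simp: facing_def)
next
  case (Return j)
  then show ?thesis using assms by (cases "j = 0") (auto simp: facing_def of_nat_diff)
next
  case Front
  then show ?thesis using assms by (auto simp: facing_def) (smt (verit))
next
  case (Gap m)
  then show ?thesis using assms by (auto simp: facing_def) (smt (verit))+
next
  case (Fork m)
  then show ?thesis using assms by (auto simp: facing_def)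
next
  case (Trapped j)
  then show ?thesis using assms by (cases "j = 0") (auto simp: facing_def of_nat_diff)
qed

lemma shape_behind:
  assumes "shape s A B" "A 0" "\<not> A (-1)"
  shows "facing (next_phase s (entered B (-1))) (\<lambda>i. i = 0 \<or> A (i - 1)) (\<lambda>i. B (i - 1))"
proof (cases s)
  case (Straight r)
  then show ?thesis using assms by (auto simp: facing_def)
next
  case (Turn r)
  then show ?thesis using assms by (cases "r = 0") (auto simp: facing_def of_nat_diff)
next
  case (Return j)
  then show ?thesis using assms by (auto simp: facing_def)
next
  case Front
  then show ?thesis using assms by (auto simp: facing_def)
next
  case (Gap m)
  then show ?thesis using assms by (auto simp: facing_def)
next
  case (Fork m)
  then show ?thesis using assms by (auto simp: facing_def of_nat_diff)
next
  case (Trapped j)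
  then show ?thesis using assms by (auto simp: facing_def)
qed

lemma shape_across:
  assumes "shape s A B" "A 0" "\<not> B 0"
  shows "facing (next_phase s Across) (\<lambda>i. i = 0 \<or> B i) A"
proof (cases s)
  case (Straight r)
  then show ?thesis using assms by (auto simp: facing_def)
next
  case (Turn r)
  then show ?thesis using assms by (auto simp: facing_def)
next
  case (Return j)
  then show ?thesis using assms by (auto simp: facing_def)
next
  case Front
  then show ?thesis using assms by (auto simp: facing_def) (smt (verit))
next
  case (Gap m)
  then show ?thesis using assms by (auto simp: facing_def)
next
  case (Fork m)
  then show ?thesis using assms by (auto simp: facing_def)
next
  case (Trapped j)
  then show ?thesis using assms by (auto simp: facing_def)
qed


lemma facing_ahead:
  assumes "facing s A B" "A 0" "\<not> A 1"
  shows "facing (next_phase s (entered B 1)) (\<lambda>i. i = 0 \<or> A (i + 1)) (\<lambda>i. B (i + 1))"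
  using assms(1) unfolding facing_def[of s A B]
proof
  assume "shape s (\<lambda>i. A (-i)) (\<lambda>i. B (-i))"
  from shape_behind[OF this] assms
  have "facing (next_phase s (entered B 1)) (\<lambda>i. i = 0 \<or> A (1 - i)) (\<lambda>i. B (1 - i))" by simp
  then show ?thesis
    using facing_flip[of _ "\<lambda>i. i = 0 \<or> A (i + 1)" "\<lambda>i. B (i + 1)"] by simp
qed (use shape_ahead assms in blast)

lemma facing_behind:
  assumes "facing s A B" "A 0" "\<not> A (-1)"
  shows "facing (next_phase s (entered B (-1))) (\<lambda>i. i = 0 \<or> A (i - 1)) (\<lambda>i. B (i - 1))"
  using facing_ahead[of s "\<lambda>i. A (-i)" "\<lambda>i. B (-i)"] assms
    facing_flip[of _ "\<lambda>i. i = 0 \<or> A (i - 1)" "\<lambda>i. B (i - 1)"]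
  by (simp add: facing_flip)

lemma facing_across:
  assumes "facing s A B" "A 0" "\<not> B 0"
  shows "facing (next_phase s Across) (\<lambda>i. i = 0 \<or> B i) A"
  using assms(1) unfolding facing_def[of s A B]
proof
  assume "shape s (\<lambda>i. A (-i)) (\<lambda>i. B (-i))"
  from shape_across[OF this] assms
  have "facing (next_phase s Across) (\<lambda>i. i = 0 \<or> B (- i)) (\<lambda>i. A (- i))" by simp
  then show ?thesis
    using facing_flip[of _ "\<lambda>i. i = 0 \<or> B i" A] by simp
qed (use shape_across assms in blast)

lemma facing_stuck:
  assumes "facing s A B"
  shows "s = Trapped 0 \<longleftrightarrow> A 1 \<and> A (-1) \<and> B 0"
  using assms shape_not_stuck[of s A B] shape_not_stuck[of s "\<lambda>i. A (-i)" "\<lambda>i. B (-i)"]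
    shape_stuck[of A B] shape_stuck[of "\<lambda>i. A (-i)" "\<lambda>i. B (-i)"]
  by (auto simp: facing_def simp del: shape.simps)

lemma facing_mean:
  assumes "C > 0" "facing s A B" "s \<noteq> Trapped 0"
  shows "(ahead C A B * \<phi> (entered B 1) + behind C A B * \<phi> (entered B (-1)) + across C A B * \<phi> Across)
      / (ahead C A B + behind C A B + across C A B) = mean_next C s \<phi>"
  using assms(2) unfolding facing_def
proof
  assume "shape s (\<lambda>i. A (-i)) (\<lambda>i. B (-i))"
  moreover have "weight C (B 0) (B (-1)) (B 1) = across C A B"
    by (simp add: weight_def add.commute)
  ultimately show ?thesis
    using shape_mean[OF assms(1) _ assms(3), of "\<lambda>i. A (-i)" "\<lambda>i. B (-i)" \<phi>]
    by (simp add: add_ac split del: if_split)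
qed (use shape_mean assms in blast)

definition same_row :: "(int \<times> nat) list \<Rightarrow> int \<Rightarrow> bool" where
  "same_row P i \<longleftrightarrow> (fst (last P) + i, snd (last P)) \<in> set P"

definition other_row :: "(int \<times> nat) list \<Rightarrow> int \<Rightarrow> bool" where
  "other_row P i \<longleftrightarrow> (fst (last P) + i, 3 - snd (last P)) \<in> set P"

text \<open>
  The invariant of the walk. That the visited columns form an interval makes the width grow by
  exactly 1 with each fresh column.
\<close>
definition tracked :: "(int \<times> nat) list \<Rightarrow> bool" where
  "tracked P \<longleftrightarrow> P \<noteq> [] \<and> set P \<subseteq> ladder_verts \<and> (\<exists>lo hi. fst ` set P = {lo..hi}) \<and>
     facing (phase P) (same_row P) (other_row P)"

lemma ladder_adj_iff:
  "(x, y) \<in> ladder_verts \<Longrightarrow> ladder_adj (x, y) w \<longleftrightarrow> w \<in> {(x + 1, y), (x - 1, y), (x, 3 - y)}"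
  by (cases w) (auto simp: ladder_adj_def ladder_verts_def)

lemma ladder_row_flip: "(x, y) \<in> ladder_verts \<Longrightarrow> 3 - y \<noteq> y \<and> 3 - (3 - y) = y \<and> (z, 3 - y) \<in> ladder_verts"
  by (auto simp: ladder_verts_def)

lemma tracked_last:
  assumes "tracked P"
  shows "last P \<in> set P" "last P \<in> ladder_verts" "same_row P 0"
  using assms by (auto simp: tracked_def same_row_def)

lemma avail_ladder:
  assumes "last P = (a, b)" "(a, b) \<in> ladder_verts"
  shows "avail ladder_adj P = {w \<in> {(a + 1, b), (a - 1, b), (a, 3 - b)}. w \<notin> set P}"
  using assms by (auto simp: avail_def ladder_adj_iff)

lemma energy_ladder:
  assumes "(x, y) \<in> ladder_verts"
  shows "energy ladder_adj C P (x, y) = C ^ (of_bool ((x + 1, y) \<in> set P - {last P})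
     + of_bool ((x - 1, y) \<in> set P - {last P}) + of_bool ((x, 3 - y) \<in> set P - {last P}))"
proof -
  let ?N = "{(x + 1, y), (x - 1, y), (x, 3 - y)}" and ?V = "set P - {last P}"
  have "{u \<in> ?V. ladder_adj (x, y) u} = ?N \<inter> {u. u \<in> ?V}"
    using assms by (auto simp: ladder_adj_iff)
  then have "card {u \<in> ?V. ladder_adj (x, y) u} = (\<Sum>u\<in>?N. of_bool (u \<in> ?V))"
    by (simp add: sum_of_bool_eq)
  also have "\<dots> = of_bool ((x + 1, y) \<in> ?V) + of_bool ((x - 1, y) \<in> ?V) + of_bool ((x, 3 - y) \<in> ?V)"
    using ladder_row_flip[OF assms] by (simp add: add.assoc)
  finally show ?thesis by (simp add: energy_def)
qed

text \<open>
  Whether a neighbouring column is fresh can be read off its vertex in the other row, as the vertex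
  in the walker's row is the unvisited candidate itself.
\<close>
lemma move_kind_horizontal:
  assumes "set P \<subseteq> ladder_verts" "last P = (a, b)" "(a, b) \<in> ladder_verts" "i \<noteq> 0" "(a + i, b) \<notin> set P"
  shows "move_kind P (a + i, b) = entered (other_row P) i"
proof -
  have "a + i \<in> fst ` set P \<longleftrightarrow> (a + i, 3 - b) \<in> set P"
  proof
    assume "a + i \<in> fst ` set P"
    then obtain y where y: "(a + i, y) \<in> set P" by force
    with assms have "y = 3 - b" by (auto simp: ladder_verts_def)
    with y show "(a + i, 3 - b) \<in> set P" by simp
  qed force
  with assms show ?thesis by (simp add: move_kind_def other_row_def)
qed

text \<open>
  The three neighbours of the walker contribute one summand each; visited neighbours carry
  weight 0 and so may be included.
\<close>
lemma sum_avail_energy: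
  assumes "tracked P"
  shows "(\<Sum>w\<in>avail ladder_adj P. energy ladder_adj C P w * \<phi> (move_kind P w)) =
    ahead C (same_row P) (other_row P) * \<phi> (entered (other_row P) 1)
    + behind C (same_row P) (other_row P) * \<phi> (entered (other_row P) (-1))
    + across C (same_row P) (other_row P) * \<phi> Across"
proof -
  obtain a b where ab: "last P = (a, b)" by fastforce
  have tr: "set P \<subseteq> ladder_verts" using assms by (simp add: tracked_def)
  have v: "(a, b) \<in> ladder_verts" and l: "(a, b) \<in> set P"
    using tracked_last[OF assms] ab by auto
  have v': "(x, b) \<in> ladder_verts" for x using v by (auto simp: ladder_verts_def)
  note flip = ladder_row_flip[OF v]
  have e1: "energy ladder_adj C P (a + 1, b) = C ^ (of_bool (same_row P 2) + of_bool (other_row P 1))"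
    and e2: "energy ladder_adj C P (a - 1, b) = C ^ (of_bool (same_row P (-2)) + of_bool (other_row P (-1)))"
    and e3: "energy ladder_adj C P (a, 3 - b) = C ^ (of_bool (other_row P 1) + of_bool (other_row P (-1)))"
    using flip v by (simp_all add: energy_ladder v' same_row_def other_row_def ab algebra_simps)
  let ?g = "\<lambda>w. energy ladder_adj C P w * \<phi> (move_kind P w)"
  have "(\<Sum>w\<in>avail ladder_adj P. ?g w) =
      (\<Sum>w\<in>{(a + 1, b), (a - 1, b), (a, 3 - b)}. if w \<notin> set P then ?g w else 0)"
    unfolding avail_ladder[OF ab v] by (rule sum.inter_filter) simp
  also have "\<dots> = (if (a + 1, b) \<notin> set P then ?g (a + 1, b) else 0)
      + (if (a - 1, b) \<notin> set P then ?g (a - 1, b) else 0)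
      + (if (a, 3 - b) \<notin> set P then ?g (a, 3 - b) else 0)"
    using flip by (simp add: add.assoc)
  also have "(if (a + 1, b) \<notin> set P then ?g (a + 1, b) else 0) =
      ahead C (same_row P) (other_row P) * \<phi> (entered (other_row P) 1)"
    using move_kind_horizontal[of P a b 1] tr v ab e1
    by (simp add: weight_def same_row_def)
  also have "(if (a - 1, b) \<notin> set P then ?g (a - 1, b) else 0) =
      behind C (same_row P) (other_row P) * \<phi> (entered (other_row P) (-1))"
    using move_kind_horizontal[of P a b "-1"] tr v ab e2
    by (simp add: weight_def same_row_def)
  also have "(if (a, 3 - b) \<notin> set P then ?g (a, 3 - b) else 0) =
      across C (same_row P) (other_row P) * \<phi> Across"
    using ab e3 by (simp add: weight_def other_row_def move_kind_def)
  finally show ?thesis .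
qed

lemma tracked_mean:
  assumes "C > 0" "tracked P" "phase P \<noteq> Trapped 0"
  shows "(\<Sum>w\<in>avail ladder_adj P. gsaw_prob ladder_adj C P w * \<phi> (move_kind P w)) = mean_next C (phase P) \<phi>"
proof -
  let ?A = "same_row P" and ?B = "other_row P"
  have "(\<Sum>w\<in>avail ladder_adj P. gsaw_prob ladder_adj C P w * \<phi> (move_kind P w)) =
    (\<Sum>w\<in>avail ladder_adj P. energy ladder_adj C P w * \<phi> (move_kind P w)) /
    (\<Sum>w\<in>avail ladder_adj P. energy ladder_adj C P w)"
    by (simp add: gsaw_prob_def sum_divide_distrib)
  moreover have "(\<Sum>w\<in>avail ladder_adj P. energy ladder_adj C P w) =
      ahead C ?A ?B + behind C ?A ?B + across C ?A ?B"
    using sum_avail_energy[OF assms(2), of C "\<lambda>_. 1"] by simp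
  ultimately show ?thesis
    using facing_mean[OF assms(1) _ assms(3), of ?A ?B \<phi>] assms(2)
    by (simp only: sum_avail_energy[OF assms(2)] tracked_def)
qed

lemma tracked_stuck:
  assumes "tracked P"
  shows "avail ladder_adj P = {} \<longleftrightarrow> phase P = Trapped 0"
proof -
  obtain a b where ab: "last P = (a, b)" by fastforce
  then have "(a, b) \<in> ladder_verts" using tracked_last[OF assms] by auto
  from avail_ladder[OF ab this] ab show ?thesis
    using facing_stuck[of "phase P" "same_row P" "other_row P"] assms
    by (auto simp: tracked_def same_row_def other_row_def)
qed

lemma path_width_interval:
  assumes "fst ` set P = {lo..hi}" "P \<noteq> []"
  shows "path_width P = hi - lo"
proof -
  have "{lo..hi} \<noteq> {}" unfolding assms(1)[symmetric] using assms(2) by simp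
  then have "Max {lo..hi} = hi" "Min {lo..hi} = lo" by (auto intro!: Max_eqI Min_eqI)
  then show ?thesis by (simp add: path_width_def assms)
qed

text \<open>
  A neighbour of the walker outside the interval of visited columns lies just beyond one of its ends,
  so the interval grows by one column.
\<close>
lemma tracked_step:
  assumes tr: "tracked P" and w: "w \<in> avail ladder_adj P"
  shows "tracked (P @ [w])"
    and "path_width (P @ [w]) = path_width P + of_bool (move_kind P w = Fresh)"
proof -
  obtain a b where ab: "last P = (a, b)" by fastforce
  note tr' = tr[unfolded tracked_def]
  have v: "(a, b) \<in> ladder_verts" and l: "(a, b) \<in> set P" and P: "P \<noteq> []"
    using tracked_last[OF tr] ab tr' by auto
  note flip = ladder_row_flip[OF v]
  from w avail_ladder[OF ab v]
  have w_cases: "w = (a + 1, b) \<or> w = (a - 1, b) \<or> w = (a, 3 - b)" and w_new: "w \<notin> set P" by auto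
  from tr' obtain lo hi where I: "fst ` set P = {lo..hi}" by auto
  with l have a: "lo \<le> a" "a \<le> hi" by force+
  have I': "fst ` set (P @ [w]) = insert (fst w) {lo..hi}" using I by auto
  have width: "path_width P = hi - lo" by (rule path_width_interval[OF I P])
  have "(\<exists>lo hi. fst ` set (P @ [w]) = {lo..hi}) \<and>
      path_width (P @ [w]) = path_width P + of_bool (move_kind P w = Fresh)"
  proof (cases "fst w \<in> {lo..hi}")
    case True
    then have "fst ` set (P @ [w]) = {lo..hi}" using I' by auto
    moreover have "move_kind P w \<noteq> Fresh" using True I by (simp add: move_kind_def)
    ultimately show ?thesis using path_width_interval[of "P @ [w]"] width by auto
  next
    case False
    then have F: "move_kind P w = Fresh" using I a ab by (auto simp: move_kind_def)
    have "fst w = a + 1 \<and> a = hi \<or> fst w = a - 1 \<and> a = lo"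
      using False w_cases a by auto
    then show ?thesis
    proof
      assume "fst w = a + 1 \<and> a = hi"
      then have "fst ` set (P @ [w]) = {lo..hi + 1}" using I' a by auto
      then show ?thesis using path_width_interval[of "P @ [w]" lo "hi + 1"] width F by auto
    next
      assume "fst w = a - 1 \<and> a = lo"
      then have "fst ` set (P @ [w]) = {lo - 1..hi}" using I' a by auto
      then show ?thesis using path_width_interval[of "P @ [w]" "lo - 1" hi] width F by auto
    qed
  qed
  moreover have "facing (phase (P @ [w])) (same_row (P @ [w])) (other_row (P @ [w]))"
    using w_cases
  proof (elim disjE)
    assume w1: "w = (a + 1, b)"
    have "same_row (P @ [w]) = (\<lambda>i. i = 0 \<or> same_row P (i + 1))"
      "other_row (P @ [w]) = (\<lambda>i. other_row P (i + 1))"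
      using flip by (auto simp: same_row_def other_row_def ab w1 fun_eq_iff add_ac)
    moreover have "\<not> same_row P 1" using w_new w1 ab by (simp add: same_row_def)
    ultimately show ?thesis
      using facing_ahead[of "phase P" "same_row P" "other_row P"] tr' tracked_last[OF tr]
        move_kind_horizontal[of P a b 1] ab v w1 w_new by (simp add: phase_snoc)
  next
    assume w1: "w = (a - 1, b)"
    have "same_row (P @ [w]) = (\<lambda>i. i = 0 \<or> same_row P (i - 1))"
      "other_row (P @ [w]) = (\<lambda>i. other_row P (i - 1))"
      using flip by (auto simp: same_row_def other_row_def ab w1 fun_eq_iff algebra_simps)
    moreover have "\<not> same_row P (-1)" using w_new w1 ab by (simp add: same_row_def)
    ultimately show ?thesis
      using facing_behind[of "phase P" "same_row P" "other_row P"] tr' tracked_last[OF tr]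
        move_kind_horizontal[of P a b "-1"] ab v w1 w_new by (simp add: phase_snoc)
  next
    assume w1: "w = (a, 3 - b)"
    have "same_row (P @ [w]) = (\<lambda>i. i = 0 \<or> other_row P i)"
      "other_row (P @ [w]) = same_row P"
      using flip by (auto simp: same_row_def other_row_def ab w1 fun_eq_iff)
    moreover have "\<not> other_row P 0" using w_new w1 ab by (simp add: other_row_def)
    moreover have "move_kind P w = Across" using w1 ab by (simp add: move_kind_def)
    ultimately show ?thesis
      using facing_across[of "phase P" "same_row P" "other_row P"] tr' tracked_last[OF tr]
      by (simp add: phase_snoc P)
  qed
  moreover have "w \<in> ladder_verts" using w by (simp add: avail_def ladder_adj_def)
  ultimately show "tracked (P @ [w])"
    and "path_width (P @ [w]) = path_width P + of_bool (move_kind P w = Fresh)"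
    using tr' unfolding tracked_def by auto
qed

lemma tracked_start:
  assumes "v \<in> ladder_verts"
  shows "tracked [v]"
proof -
  obtain a b where v: "v = (a, b)" by fastforce
  have "\<exists>lo hi. fst ` set [v] = {lo..hi}" by (intro exI[of _ a]) (simp add: v)
  moreover have "same_row [v] = (\<lambda>i. i = 0)" "other_row [v] = (\<lambda>_. False)"
    using assms by (auto simp: same_row_def other_row_def v ladder_verts_def)
  ultimately show ?thesis
    using assms by (auto simp: tracked_def phase_single facing_def)
qed

text \<open>
  The length parameter of a phase. It is bounded by the length of the path, which turns growth
  estimates over the phases into growth estimates over the paths.
\<close>
fun index :: "phase \<Rightarrow> nat" where
  "index (Straight r) = r" | "index (Turn r) = r" | "index (Return j) = j" | "index Front = 0"
| "index (Gap m) = m" | "index (Fork m) = m" | "index (Trapped j) = j"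

lemma index_next_phase: "index (next_phase s k) \<le> Suc (index s)"
  by (cases s) auto

lemma index_phase: "P \<noteq> [] \<Longrightarrow> index (phase P) < length P"
proof (induction P rule: rev_induct)
  case (snoc w P)
  then show ?case
    using index_next_phase[of "phase P" "move_kind P w"]
    by (cases "P = []") (auto simp: phase_snoc phase_single)
qed simp

section \<open>Moments of the remaining cost\<close>

text \<open>
  Apart from the terminal phase, this excludes \<open>Gap 0\<close> and \<open>Fork 0\<close>, which describe no path.
\<close>
definition live :: "phase \<Rightarrow> bool" where
  "live s \<longleftrightarrow> s \<notin> {Trapped 0, Gap 0, Fork 0}"

text \<open>
  With \<open>b = 1\<close> the total cost of a walk is its number of steps, with \<open>b = 0\<close> its width.
\<close>
definition cost :: "real \<Rightarrow> move \<Rightarrow> real" where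
  "cost b k = (if k = Fresh then 1 else b)"

locale ladder_values =
  fixes C b :: real
  assumes C_pos: "C > 0"
begin

text \<open>
  When a vertex with one visited neighbour besides the walker's position competes with a vertex in a
  fresh column, \<open>q\<close> is the probability that the former is chosen and \<open>p\<close> the probability of the
  latter; \<open>q'\<close> and \<open>p'\<close> are their analogues for two visited neighbours.
\<close>
definition q where "q = C / (1 + C)"
definition p where "p = 1 / (1 + C)"
definition q' where "q' = C\<^sup>2 / (1 + C\<^sup>2)"
definition p' where "p' = 1 / (1 + C\<^sup>2)"

lemma pq: "p = 1 - q" "p' = 1 - q'" "p > 0" "q > 0" "p' > 0" "q' > 0"
proof -
  have "1 + C > 0" "1 + C\<^sup>2 > 0" using C_pos by (auto intro: add_pos_pos)
  then show "p = 1 - q" "p' = 1 - q'" "p > 0" "q > 0" "p' > 0" "q' > 0"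
    using C_pos by (simp_all add: p_def q_def p'_def q'_def divide_simps)
qed

lemma mean_next_pq:
  "mean_next C (Straight r) \<phi> =
     (if r = 0 then (\<phi> Across + 2 * \<phi> Fresh) / 3 else (\<phi> Across + \<phi> Fresh) / 2)"
  "mean_next C (Turn r) \<phi> = (if r = 0 then \<phi> Fresh else q * \<phi> Back + p * \<phi> Fresh)"
  "mean_next C (Return j) \<phi> = (if j = 0 then \<phi> Fresh else \<phi> Back)"
  "mean_next C Front \<phi> = q * \<phi> Across + p * \<phi> Fresh"
  "mean_next C (Gap m) \<phi> = (\<phi> Across + \<phi> Fresh) / 2"
  "mean_next C (Fork m) \<phi> = (if m = 1 then q' * \<phi> Back + p' * \<phi> Fresh else q * \<phi> Back + p * \<phi> Fresh)"
  "mean_next C (Trapped j) \<phi> = \<phi> Back"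
  by (simp_all add: p_def q_def p'_def q'_def add_divide_distrib)

lemma mean_next_linear:
  "mean_next C s (\<lambda>k. a + d * \<phi> k + \<psi> k) = a + d * mean_next C s \<phi> + mean_next C s \<psi>"
  by (cases s) (auto simp: mean_next_pq pq(1,2) field_simps simp del: mean_next.simps)

text \<open>
  The expected cost to come from \<open>Front\<close>. It occurs on both sides of the equation
  \<open>\<rho> = q * (b + 1 + \<rho>) + p * (1 + V (Gap 1))\<close>, and solving for it divides by its collected
  coefficient \<open>p * (q + q') / 2\<close>.
\<close>
definition \<rho> :: real where
  "\<rho> = (2 * q * (b + 1) + p * (4 + 2 * b + p + p' + b * (q' + 3 * q))) / (p * (q + q'))"

text \<open>
  The constant terms of the affine solutions \<open>g + b * q * m\<close> at \<open>Gap m\<close> for \<open>m \<noteq> 1\<close> and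
  \<open>s\<^sub>0 + b * q * r\<close> at \<open>Straight r\<close> for \<open>r > 0\<close>. The slope \<open>b * q\<close> is the cost per vertex of the way back
  times the probability that the way back is taken.
\<close>
definition g where "g = b + 1 + b * q + p * (1 + \<rho>)"

definition s\<^sub>0 where "s\<^sub>0 = b + 2 + \<rho> + b * q"

text \<open>
  The expected cost to come. \<open>Gap 1\<close> and \<open>Fork 1\<close> stand apart because of the weight \<open>C\<^sup>2\<close>, and
  \<open>Straight 0\<close> because of the three choices at the start.
\<close>
fun V :: "phase \<Rightarrow> real" where
  "V (Straight r) = (if r = 0 then (b + 1 + \<rho> + 2 * (1 + s\<^sub>0 + b * q)) / 3 else s\<^sub>0 + b * q * r)"
| "V (Turn r) = 1 + \<rho> + b * q * r"
| "V (Return j) = 1 + \<rho> + b * j"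
| "V Front = \<rho>"
| "V (Gap m) = (if m = 1 then (b + p' * (1 + \<rho>) + b * q' + 1 + g + 2 * b * q) / 2 else g + b * q * m)"
| "V (Fork m) = (if m = 1 then p' * (1 + \<rho>) + b * q' else p * (1 + \<rho>) + b * q * m)"
| "V (Trapped j) = b * j"

lemma V_recursion:
  assumes "live s"
  shows "mean_next C s (\<lambda>k. cost b k + V (next_phase s k)) = V s"
proof (cases s)
  case (Straight r)
  then show ?thesis by (auto simp: mean_next_pq cost_def s\<^sub>0_def field_simps simp del: mean_next.simps)
next
  case (Turn r)
  then show ?thesis
    by (auto simp: mean_next_pq cost_def pq(1) of_nat_diff Suc_leI algebra_simps simp del: mean_next.simps)
next
  case (Return j)
  then show ?thesis by (auto simp: mean_next_pq cost_def of_nat_diff Suc_leI algebra_simps simp del: mean_next.simps)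
next
  case Front
  have "p * (q + q') \<noteq> 0" using pq(3-6) by simp
  then have "\<rho> * (p * (q + q')) = 2 * q * (b + 1) + p * (4 + 2 * b + p + p' + b * (q' + 3 * q))"
    by (simp add: \<rho>_def)
  then have "q * (b + (1 + \<rho>)) + p * (1 + V (Gap 1)) = \<rho>"
    unfolding V.simps g_def pq(1,2) by (simp; algebra)
  then show ?thesis using Front by (simp add: mean_next_pq cost_def del: mean_next.simps V.simps(5))
next
  case (Gap m)
  then show ?thesis using assms by (auto simp: mean_next_pq cost_def live_def g_def pq(1) field_simps simp del: mean_next.simps)
next
  case (Fork m)
  then show ?thesis using assms
    by (auto simp: mean_next_pq cost_def live_def of_nat_diff Suc_leI algebra_simps simp del: mean_next.simps)
next
  case (Trapped j)
  then show ?thesis using assms by (auto simp: mean_next_pq cost_def live_def of_nat_diff Suc_leI algebra_simps simp del: mean_next.simps)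
qed

text \<open>
  The coefficients of the quadratic solutions for the second moment: it is
  \<open>(A + p * u) + B * m + b\<^sup>2 * q * m\<^sup>2\<close> at \<open>Gap m\<close> for \<open>m \<noteq> 1\<close> and \<open>D + E * r + b\<^sup>2 * q * r\<^sup>2\<close> at \<open>Straight r\<close> for
  \<open>r > 0\<close>. Further, \<open>\<sigma>\<close> is the second moment at \<open>Front\<close>, again obtained by solving for it with the
  coefficient \<open>p * (q + q') / 2\<close>, and \<open>u\<close> is the second moment just before a step into \<open>Front\<close>. As
  \<open>A\<close> is used to define \<open>\<sigma>\<close>, it leaves out the term with \<open>u\<close>.
\<close>
definition B where "B = 4 * b\<^sup>2 * q + 2 * b * q"

definition A where
  "A = b\<^sup>2 + 2 * b * (p * (1 + \<rho>)) + 1 + 2 * g + 2 * b * q + B + b\<^sup>2 * q"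

definition \<sigma> :: real where
  "\<sigma> = (2 * q * (b\<^sup>2 + 2 * b * (1 + \<rho>) + 1 + 2 * \<rho>)
     + p * (2 + 4 * V (Gap 1) + b\<^sup>2 + 2 * b * V (Fork 1) + p' * (1 + 2 * \<rho>) + b\<^sup>2 * q' + 1
            + 2 * V (Gap 2) + A + p * (1 + 2 * \<rho>) + 2 * B + 4 * b\<^sup>2 * q)) / (p * (q + q'))"

definition u where "u = 1 + 2 * \<rho> + \<sigma>"

definition E where "E = 4 * b\<^sup>2 * q + 2 * b * q + 2 * b * q * (1 + \<rho>)"

definition D where
  "D = b\<^sup>2 + 2 * b * (1 + \<rho>) + u + 1 + 2 * s\<^sub>0 + 2 * b * q + E + b\<^sup>2 * q"

text \<open>
  The second moment of the cost to come. If the next move costs \<open>c\<close> and leads to a phase with moments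
  \<open>v\<close> and \<open>w\<close>, it contributes \<open>c\<^sup>2 + 2 * c * v + w\<close> by expanding the square of the total cost.
\<close>
fun W :: "phase \<Rightarrow> real" where
  "W (Straight r) = (if r = 0 then (b\<^sup>2 + 2 * b * (1 + \<rho>) + u + 2 * (1 + 2 * (s\<^sub>0 + b * q) + D + E + b\<^sup>2 * q)) / 3
     else D + E * r + b\<^sup>2 * q * (real r)\<^sup>2)"
| "W (Turn r) = u + 2 * b * q * (1 + \<rho>) * r + b\<^sup>2 * q * (real r)\<^sup>2"
| "W (Return j) = u + 2 * b * (1 + \<rho>) * j + b\<^sup>2 * (real j)\<^sup>2"
| "W Front = \<sigma>"
| "W (Gap m) = (if m = 1 then (b\<^sup>2 + 2 * b * V (Fork 1) + p' * u + b\<^sup>2 * q' + 1 + 2 * V (Gap 2)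
        + A + p * u + 2 * B + 4 * b\<^sup>2 * q) / 2
     else A + p * u + B * m + b\<^sup>2 * q * (real m)\<^sup>2)"
| "W (Fork m) = (if m = 1 then p' * u + b\<^sup>2 * q' else p * u + b\<^sup>2 * q * (real m)\<^sup>2)"
| "W (Trapped j) = b\<^sup>2 * (real j)\<^sup>2"

lemma W_recursion:
  assumes "live s"
  shows "mean_next C s (\<lambda>k. (cost b k)\<^sup>2 + 2 * cost b k * V (next_phase s k) + W (next_phase s k)) = W s"
proof (cases s)
  case (Straight r)
  then show ?thesis
    by (auto simp: mean_next_pq cost_def s\<^sub>0_def D_def E_def power2_eq_square field_simps simp del: mean_next.simps)
next
  case (Turn r)
  then show ?thesis
    by (auto simp: mean_next_pq cost_def pq(1) u_def of_nat_diff Suc_leI power2_eq_square algebra_simps simp del: mean_next.simps)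
next
  case (Return j)
  then show ?thesis
    by (auto simp: mean_next_pq cost_def u_def of_nat_diff Suc_leI power2_eq_square algebra_simps simp del: mean_next.simps)
next
  case Front
  have "p * (q + q') \<noteq> 0" using pq(3-6) by simp
  then have "\<sigma> * (p * (q + q')) = 2 * q * (b\<^sup>2 + 2 * b * (1 + \<rho>) + 1 + 2 * \<rho>)
     + p * (2 + 4 * V (Gap 1) + b\<^sup>2 + 2 * b * V (Fork 1) + p' * (1 + 2 * \<rho>) + b\<^sup>2 * q' + 1
            + 2 * V (Gap 2) + A + p * (1 + 2 * \<rho>) + 2 * B + 4 * b\<^sup>2 * q)"
    by (simp add: \<sigma>_def del: V.simps)
  moreover have "2 * W (Gap 1) = b\<^sup>2 + 2 * b * V (Fork 1) + p' * u + b\<^sup>2 * q' + 1 + 2 * V (Gap 2)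
        + A + p * u + 2 * B + 4 * b\<^sup>2 * q"
    by (simp del: V.simps)
  ultimately have "q * (b\<^sup>2 + 2 * b * (1 + \<rho>) + u) + p * (1 + 2 * V (Gap 1) + W (Gap 1)) = \<sigma>"
    unfolding u_def pq(1,2) by algebra
  then show ?thesis using Front by (simp add: mean_next_pq cost_def del: mean_next.simps V.simps(5) W.simps(5))
next
  case (Gap m)
  then show ?thesis using assms
    by (auto simp: mean_next_pq cost_def live_def A_def B_def power2_eq_square field_simps simp del: mean_next.simps)
next
  case (Fork m)
  then show ?thesis using assms
    by (auto simp: mean_next_pq cost_def live_def u_def of_nat_diff Suc_leI power2_eq_square algebra_simps simp del: mean_next.simps)
next
  case (Trapped j)
  then show ?thesis using assms
    by (auto simp: mean_next_pq cost_def live_def of_nat_diff Suc_leI power2_eq_square algebra_simps simp del: mean_next.simps)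
qed

text \<open>
  Each branch of \<open>V\<close> and \<open>W\<close> is a polynomial in its length parameter up to one exceptional value; the
  exceptional value is absorbed by the constant.
\<close>
lemma affine_growth:
  assumes "\<And>n::nat. n \<noteq> k \<Longrightarrow> f n = x + y * real n"
  obtains K where "\<And>n. \<bar>f n\<bar> \<le> K * (1 + real n)"
proof
  fix n :: nat
  have "\<bar>f n\<bar> \<le> \<bar>f k\<bar> + (\<bar>x\<bar> + \<bar>y\<bar> * real n)"
  proof (cases "n = k")
    case False
    then show ?thesis using assms abs_triangle_ineq[of x "y * real n"] by (simp add: abs_mult)
  qed simp
  also have "\<dots> \<le> (\<bar>f k\<bar> + \<bar>x\<bar> + \<bar>y\<bar>) * (1 + real n)"
    by (simp add: algebra_simps)
  finally show "\<bar>f n\<bar> \<le> (\<bar>f k\<bar> + \<bar>x\<bar> + \<bar>y\<bar>) * (1 + real n)" .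
qed

lemma quadratic_growth:
  assumes "\<And>n::nat. n \<noteq> k \<Longrightarrow> f n = x + y * real n + z * (real n)\<^sup>2"
  obtains K where "\<And>n. \<bar>f n\<bar> \<le> K * (1 + real n)\<^sup>2"
proof
  fix n :: nat
  have "\<bar>f n\<bar> \<le> \<bar>f k\<bar> + (\<bar>x\<bar> + \<bar>y\<bar> * real n + \<bar>z\<bar> * (real n)\<^sup>2)"
  proof (cases "n = k")
    case False
    have "\<bar>x + y * real n + z * (real n)\<^sup>2\<bar> \<le> \<bar>x\<bar> + \<bar>y * real n\<bar> + \<bar>z * (real n)\<^sup>2\<bar>"
      by linarith
    with False show ?thesis using assms by (simp add: abs_mult)
  qed simp
  also have "\<dots> \<le> (\<bar>f k\<bar> + \<bar>x\<bar> + \<bar>y\<bar> + \<bar>z\<bar>) * (1 + real n)\<^sup>2"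
    by (simp add: algebra_simps power2_eq_square)
  finally show "\<bar>f n\<bar> \<le> (\<bar>f k\<bar> + \<bar>x\<bar> + \<bar>y\<bar> + \<bar>z\<bar>) * (1 + real n)\<^sup>2" .
qed

lemma V_growth: "\<exists>K\<ge>0. \<forall>s. \<bar>V s\<bar> \<le> K * (1 + real (index s))"
proof -
  obtain K1 where K1: "\<And>n. \<bar>V (Straight n)\<bar> \<le> K1 * (1 + real n)"
    by (rule affine_growth[of 0 "\<lambda>n. V (Straight n)" "s\<^sub>0" "b * q"]) (simp, blast)
  obtain K2 where K2: "\<And>n. \<bar>V (Turn n)\<bar> \<le> K2 * (1 + real n)"
    by (rule affine_growth[of 0 "\<lambda>n. V (Turn n)" "1 + \<rho>" "b * q"]) (simp, blast)
  obtain K3 where K3: "\<And>n. \<bar>V (Return n)\<bar> \<le> K3 * (1 + real n)"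
    by (rule affine_growth[of 0 "\<lambda>n. V (Return n)" "1 + \<rho>" b]) (simp, blast)
  obtain K4 where K4: "\<And>n. \<bar>V (Gap n)\<bar> \<le> K4 * (1 + real n)"
    by (rule affine_growth[of 1 "\<lambda>n. V (Gap n)" g "b * q"]) (simp, blast)
  obtain K5 where K5: "\<And>n. \<bar>V (Fork n)\<bar> \<le> K5 * (1 + real n)"
    by (rule affine_growth[of 1 "\<lambda>n. V (Fork n)" "p * (1 + \<rho>)" "b * q"]) (simp, blast)
  obtain K6 where K6: "\<And>n. \<bar>V (Trapped n)\<bar> \<le> K6 * (1 + real n)"
    by (rule affine_growth[of 0 "\<lambda>n. V (Trapped n)" 0 b]) (simp, blast)
  let ?K = "\<bar>K1\<bar> + \<bar>K2\<bar> + \<bar>K3\<bar> + \<bar>K4\<bar> + \<bar>K5\<bar> + \<bar>K6\<bar> + \<bar>\<rho>\<bar>"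
  have mono: "x \<le> ?K * y" if "x \<le> k * y" "\<bar>k\<bar> \<le> ?K" "0 \<le> y" for x k y :: real
    using that mult_right_mono[of k ?K y] by linarith
  have "\<bar>V s\<bar> \<le> ?K * (1 + real (index s))" for s
  proof (cases s)
    case (Straight n) then show ?thesis using mono[OF K1] by (simp del: V.simps)
  next
    case (Turn n) then show ?thesis using mono[OF K2] by (simp del: V.simps)
  next
    case (Return n) then show ?thesis using mono[OF K3] by (simp del: V.simps)
  next
    case Front then show ?thesis by simp
  next
    case (Gap n) then show ?thesis using mono[OF K4] by (simp del: V.simps)
  next
    case (Fork n) then show ?thesis using mono[OF K5] by (simp del: V.simps)
  next
    case (Trapped n) then show ?thesis using mono[OF K6] by (simp del: V.simps)
  qed
  then show ?thesis by (intro exI[of _ ?K]) auto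
qed

lemma W_growth: "\<exists>K\<ge>0. \<forall>s. \<bar>W s\<bar> \<le> K * (1 + real (index s))\<^sup>2"
proof -
  obtain K1 where K1: "\<And>n. \<bar>W (Straight n)\<bar> \<le> K1 * (1 + real n)\<^sup>2"
    by (rule quadratic_growth[of 0 "\<lambda>n. W (Straight n)" D E "b\<^sup>2 * q"]) (simp, blast)
  obtain K2 where K2: "\<And>n. \<bar>W (Turn n)\<bar> \<le> K2 * (1 + real n)\<^sup>2"
    by (rule quadratic_growth[of 0 "\<lambda>n. W (Turn n)" u "2 * b * q * (1 + \<rho>)" "b\<^sup>2 * q"]) (simp, blast)
  obtain K3 where K3: "\<And>n. \<bar>W (Return n)\<bar> \<le> K3 * (1 + real n)\<^sup>2"
    by (rule quadratic_growth[of 0 "\<lambda>n. W (Return n)" u "2 * b * (1 + \<rho>)" "b\<^sup>2"]) (simp, blast)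
  obtain K4 where K4: "\<And>n. \<bar>W (Gap n)\<bar> \<le> K4 * (1 + real n)\<^sup>2"
    by (rule quadratic_growth[of 1 "\<lambda>n. W (Gap n)" "A + p * u" B "b\<^sup>2 * q"]) (simp, blast)
  obtain K5 where K5: "\<And>n. \<bar>W (Fork n)\<bar> \<le> K5 * (1 + real n)\<^sup>2"
    by (rule quadratic_growth[of 1 "\<lambda>n. W (Fork n)" "p * u" 0 "b\<^sup>2 * q"]) (simp, blast)
  obtain K6 where K6: "\<And>n. \<bar>W (Trapped n)\<bar> \<le> K6 * (1 + real n)\<^sup>2"
    by (rule quadratic_growth[of 0 "\<lambda>n. W (Trapped n)" 0 0 "b\<^sup>2"]) (simp, blast)
  let ?K = "\<bar>K1\<bar> + \<bar>K2\<bar> + \<bar>K3\<bar> + \<bar>K4\<bar> + \<bar>K5\<bar> + \<bar>K6\<bar> + \<bar>\<sigma>\<bar>"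
  have mono: "x \<le> ?K * y" if "x \<le> k * y" "\<bar>k\<bar> \<le> ?K" "0 \<le> y" for x k y :: real
    using that mult_right_mono[of k ?K y] by linarith
  have "\<bar>W s\<bar> \<le> ?K * (1 + real (index s))\<^sup>2" for s
  proof (cases s)
    case (Straight n) then show ?thesis using mono[OF K1] by (simp del: W.simps)
  next
    case (Turn n) then show ?thesis using mono[OF K2] by (simp del: W.simps)
  next
    case (Return n) then show ?thesis using mono[OF K3] by (simp del: W.simps)
  next
    case Front then show ?thesis by simp
  next
    case (Gap n) then show ?thesis using mono[OF K4] by (simp del: W.simps)
  next
    case (Fork n) then show ?thesis using mono[OF K5] by (simp del: W.simps)
  next
    case (Trapped n) then show ?thesis using mono[OF K6] by (simp del: W.simps)
  qed
  then show ?thesis by (intro exI[of _ ?K]) auto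
qed

lemma V_nonneg:
  assumes "b \<ge> 0"
  shows "V s \<ge> 0"
proof -
  note [simp] = order_less_imp_le[OF pq(3)] order_less_imp_le[OF pq(4)]
    order_less_imp_le[OF pq(5)] order_less_imp_le[OF pq(6)]
  have [simp]: "\<rho> \<ge> 0" using assms by (simp add: \<rho>_def)
  have [simp]: "g \<ge> 0" "s\<^sub>0 \<ge> 0" using assms by (simp_all add: g_def s\<^sub>0_def)
  show ?thesis using assms by (cases s) auto
qed

lemma W_nonneg:
  assumes "b \<ge> 0"
  shows "W s \<ge> 0"
proof -
  note [simp] = order_less_imp_le[OF pq(3)] order_less_imp_le[OF pq(4)]
    order_less_imp_le[OF pq(5)] order_less_imp_le[OF pq(6)]
  have [simp]: "\<rho> \<ge> 0" using assms by (simp add: \<rho>_def)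
  have [simp]: "g \<ge> 0" "s\<^sub>0 \<ge> 0" "B \<ge> 0" using assms by (simp_all add: g_def s\<^sub>0_def B_def)
  have [simp]: "A \<ge> 0" "E \<ge> 0" using assms by (simp_all add: A_def E_def)
  note [simp] = V_nonneg[OF assms]
  have [simp]: "\<sigma> \<ge> 0" using assms by (simp add: \<sigma>_def del: V.simps)
  have [simp]: "u \<ge> 0" by (simp add: u_def)
  have [simp]: "D \<ge> 0" using assms by (simp add: D_def)
  show ?thesis using assms by (cases s) (auto simp del: V.simps)
qed

section \<open>Closed forms for the number of steps and the width\<close>

text \<open>
  It remains to evaluate the moments at the start as rational functions of \<open>C\<close> for \<open>b = 1\<close> and
  \<open>b = 0\<close>. Going through the reduced fractions of \<open>\<rho>\<close> and \<open>\<sigma>\<close> keeps the polynomial identities small.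
\<close>
lemma \<rho>_eqI:
  assumes "x * (p * (q + q')) = 2 * q * (b + 1) + p * (4 + 2 * b + p + p' + b * (q' + 3 * q))"
  shows "\<rho> = x"
  using assms pq(3-6) unfolding \<rho>_def by (simp add: divide_eq_eq)

lemma \<sigma>_eqI:
  assumes "x * (p * (q + q')) = 2 * q * (b\<^sup>2 + 2 * b * (1 + \<rho>) + 1 + 2 * \<rho>)
     + p * (2 + 4 * V (Gap 1) + b\<^sup>2 + 2 * b * V (Fork 1) + p' * (1 + 2 * \<rho>) + b\<^sup>2 * q' + 1
            + 2 * V (Gap 2) + A + p * (1 + 2 * \<rho>) + 2 * B + 4 * b\<^sup>2 * q)"
  shows "\<sigma> = x"
  using assms pq(3-6) unfolding \<sigma>_def by (simp add: divide_eq_eq del: V.simps)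

lemma denominators: "C \<noteq> 0" "1 + C \<noteq> 0" "1 + C\<^sup>2 \<noteq> 0" "2 * C\<^sup>2 + C + 1 \<noteq> 0"
proof -
  have "1 + C\<^sup>2 > 0" "2 * C\<^sup>2 + C + 1 > 0" using C_pos by (auto intro!: add_pos_pos)
  then show "C \<noteq> 0" "1 + C \<noteq> 0" "1 + C\<^sup>2 \<noteq> 0" "2 * C\<^sup>2 + C + 1 \<noteq> 0" using C_pos by auto
qed

lemmas weights = p_def q_def p'_def q'_def

lemma steps_\<rho>:
  assumes "b = 1"
  shows "\<rho> = (4 * C^4 + 14 * C^3 + 12 * C^2 + 14 * C + 8) / (C * (2 * C^2 + C + 1))"
  using denominators by (intro \<rho>_eqI, simp add: assms weights divide_simps) algebra

lemma width_\<rho>: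
  assumes "b = 0"
  shows "\<rho> = (2 * C^4 + 6 * C^3 + 7 * C^2 + 7 * C + 6) / (C * (2 * C^2 + C + 1))"
  using denominators by (intro \<rho>_eqI, simp add: assms weights divide_simps) algebra

lemma steps_values:
  assumes b: "b = 1"
  shows "V (Gap 1) = (10 * C^3 + 9 * C^2 + 13 * C + 8) / (C * (2 * C^2 + C + 1))"
    and "V (Gap 2) = (14 * C^3 + 11 * C^2 + 9 * C + 8) / (C * (2 * C^2 + C + 1))"
    and "V (Fork 1) = (2 * C^3 + 5 * C^2 + 15 * C + 8) / (C * (2 * C^2 + C + 1))"
    and "A = (50 * C^4 + 93 * C^3 + 75 * C^2 + 66 * C + 32) / (C * (1 + C) * (2 * C^2 + C + 1))"
    and "V (Straight 0) = (12 * C^5 + 82 * C^4 + 112 * C^3 + 102 * C^2 + 76 * C + 24)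
      / (3 * C * (1 + C) * (2 * C^2 + C + 1))"
  unfolding V.simps A_def B_def g_def s\<^sub>0_def
  unfolding steps_\<rho>[OF b] weights
  unfolding b
  using denominators by (simp_all add: divide_simps; algebra)+

lemma steps_\<sigma>:
  assumes b: "b = 1"
  shows "\<sigma> = (32 * C^8 + 160 * C^7 + 436 * C^6 + 686 * C^5 + 918 * C^4 + 898 * C^3 + 642 * C^2 + 372 * C + 128)
    / (C^2 * (2 * C^2 + C + 1)^2)"
  by (rule \<sigma>_eqI, unfold steps_values[OF b] steps_\<rho>[OF b] weights B_def, unfold b,
      use denominators in \<open>simp add: divide_simps; algebra\<close>)

lemma steps_W:
  assumes b: "b = 1"
  shows "W (Straight 0) = (96 * C^9 + 800 * C^8 + 3212 * C^7 + 5710 * C^6 + 7784 * C^5 + 8088 * C^4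
     + 6248 * C^3 + 3746 * C^2 + 1660 * C + 384) / (3 * C^2 * (1 + C) * (2 * C^2 + C + 1)^2)"
  unfolding W.simps D_def E_def u_def s\<^sub>0_def
  unfolding steps_\<sigma>[OF b] steps_\<rho>[OF b] weights
  unfolding b
  using denominators by (simp add: divide_simps; algebra)

lemma width_values:
  assumes b: "b = 0"
  shows "V (Gap 1) = (3 * C^3 + 5 * C^2 + 6 * C + 6) / (C * (2 * C^2 + C + 1))"
    and "V (Gap 2) = (4 * C^3 + 7 * C^2 + 3 * C + 6) / (C * (2 * C^2 + C + 1))"
    and "V (Fork 1) = (2 * C^2 + 8 * C + 6) / (C * (2 * C^2 + C + 1))"
    and "A = (10 * C^3 + 15 * C^2 + 7 * C + 12) / (C * (2 * C^2 + C + 1))"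
    and "V (Straight 0) = (6 * C^4 + 32 * C^3 + 28 * C^2 + 28 * C + 18) / (3 * C * (2 * C^2 + C + 1))"
  unfolding V.simps A_def B_def g_def s\<^sub>0_def
  unfolding width_\<rho>[OF b] weights
  unfolding b
  using denominators by (simp_all add: divide_simps; algebra)+

lemma width_\<sigma>:
  assumes b: "b = 0"
  shows "\<sigma> = (8 * C^8 + 36 * C^7 + 106 * C^6 + 202 * C^5 + 277 * C^4 + 318 * C^3 + 251 * C^2 + 154 * C + 72)
    / (C^2 * (2 * C^2 + C + 1)^2)"
  by (rule \<sigma>_eqI, unfold width_values[OF b] width_\<rho>[OF b] weights B_def, unfold b,
      use denominators in \<open>simp add: divide_simps; algebra\<close>)

lemma width_W:
  assumes b: "b = 0"
  shows "W (Straight 0) = (24 * C^8 + 164 * C^7 + 606 * C^6 + 1006 * C^5 + 1324 * C^4 + 1364 * C^3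
     + 958 * C^2 + 546 * C + 216) / (3 * C^2 * (2 * C^2 + C + 1)^2)"
  unfolding W.simps D_def E_def u_def s\<^sub>0_def
  unfolding width_\<sigma>[OF b] width_\<rho>[OF b] weights
  unfolding b
  using denominators by (simp add: divide_simps; algebra)

end

section \<open>The total cost of a walk on the ladder\<close>

locale ladder_gsaw = locally_finite_gsaw M ladder_adj C v0 X
  for M :: "'w measure" and C v0 X +
  assumes start_on_ladder: "v0 \<in> ladder_verts"
begin

lemma grown_tracked: "grown ladder_adj v0 P \<Longrightarrow> tracked P"
  by (induction rule: grown.induct) (auto intro: tracked_start start_on_ladder tracked_step)

end

text \<open>
  The step count and the width are two instances, treated at once. The bounds on \<open>b\<close> keep the
  accumulated cost \<open>L\<close> between 0 and the length of the path.
\<close>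
locale ladder_cost = ladder_gsaw M C v0 X + ladder_values C b
  for M :: "'w measure" and C b v0 X +
  fixes L :: "(int \<times> nat) list \<Rightarrow> real"
  assumes b_bounds: "0 \<le> b" "b \<le> 1"
    and L_start: "L [v0] = 0"
    and L_step: "\<And>P w. tracked P \<Longrightarrow> w \<in> avail ladder_adj P \<Longrightarrow> L (P @ [w]) = L P + cost b (move_kind P w)"
begin

text \<open>
  The conditional expectations of the total cost and of its square, given the path so far.
\<close>
definition first :: "(int \<times> nat) list \<Rightarrow> real" where
  "first P = L P + V (phase P)"

definition second :: "(int \<times> nat) list \<Rightarrow> real" where
  "second P = (L P)\<^sup>2 + 2 * L P * V (phase P) + W (phase P)"

lemma phase_live:
  assumes "tracked P" "avail ladder_adj P \<noteq> {}"
  shows "live (phase P)"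
proof -
  have "phase P \<noteq> Trapped 0" using assms tracked_stuck by blast
  moreover have "facing (phase P) (same_row P) (other_row P)" using assms by (simp add: tracked_def)
  ultimately show ?thesis by (auto simp: live_def facing_def)
qed

lemma harmonic_first: "harmonic ladder_adj C v0 first"
  unfolding harmonic_def
proof (intro allI impI)
  fix P assume P: "grown ladder_adj v0 P" "avail ladder_adj P \<noteq> {}"
  then have tr: "tracked P" by (auto intro: grown_tracked)
  have lv: "live (phase P)" by (rule phase_live[OF tr P(2)])
  let ?\<phi> = "\<lambda>k. cost b k + V (next_phase (phase P) k)"
  have "first (P @ [w]) = L P + 1 * ?\<phi> (move_kind P w) + 0" if "w \<in> avail ladder_adj P" for w
    using tr that by (simp add: first_def L_step phase_snoc tracked_def)
  then have "(\<Sum>w\<in>avail ladder_adj P. gsaw_prob ladder_adj C P w * first (P @ [w])) =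
     (\<Sum>w\<in>avail ladder_adj P. gsaw_prob ladder_adj C P w * (\<lambda>k. L P + 1 * ?\<phi> k + (\<lambda>_. 0) k) (move_kind P w))"
    by (intro sum.cong) auto
  also have "\<dots> = mean_next C (phase P) (\<lambda>k. L P + 1 * ?\<phi> k + (\<lambda>_. 0) k)"
    using lv by (intro tracked_mean C_pos tr) (auto simp: live_def)
  also have "\<dots> = L P + V (phase P) + mean_next C (phase P) (\<lambda>_. 0)"
    unfolding mean_next_linear V_recursion[OF lv] by simp
  also have "mean_next C (phase P) (\<lambda>_. 0) = 0" by (cases "phase P") auto
  finally show "first P = (\<Sum>w\<in>avail ladder_adj P. gsaw_prob ladder_adj C P w * first (P @ [w]))"
    by (simp add: first_def)
qed

lemma harmonic_second: "harmonic ladder_adj C v0 second"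
  unfolding harmonic_def
proof (intro allI impI)
  fix P assume P: "grown ladder_adj v0 P" "avail ladder_adj P \<noteq> {}"
  then have tr: "tracked P" by (auto intro: grown_tracked)
  have lv: "live (phase P)" by (rule phase_live[OF tr P(2)])
  let ?n = "next_phase (phase P)"
  let ?\<phi> = "\<lambda>k. cost b k + V (?n k)"
  let ?\<psi> = "\<lambda>k. (cost b k)\<^sup>2 + 2 * cost b k * V (?n k) + W (?n k)"
  have "second (P @ [w]) = (L P)\<^sup>2 + 2 * L P * ?\<phi> (move_kind P w) + ?\<psi> (move_kind P w)"
    if "w \<in> avail ladder_adj P" for w
    using tr that
    by (simp add: second_def L_step phase_snoc tracked_def) (simp add: algebra_simps power2_eq_square)
  then have "(\<Sum>w\<in>avail ladder_adj P. gsaw_prob ladder_adj C P w * second (P @ [w])) =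
     (\<Sum>w\<in>avail ladder_adj P. gsaw_prob ladder_adj C P w * (\<lambda>k. (L P)\<^sup>2 + 2 * L P * ?\<phi> k + ?\<psi> k) (move_kind P w))"
    by (intro sum.cong) auto
  also have "\<dots> = mean_next C (phase P) (\<lambda>k. (L P)\<^sup>2 + 2 * L P * ?\<phi> k + ?\<psi> k)"
    using lv by (intro tracked_mean C_pos tr) (auto simp: live_def)
  also have "\<dots> = second P"
    unfolding mean_next_linear V_recursion[OF lv] W_recursion[OF lv] second_def by simp
  finally show "second P = (\<Sum>w\<in>avail ladder_adj P. gsaw_prob ladder_adj C P w * second (P @ [w]))" by simp
qed

lemma L_bounds: "grown ladder_adj v0 P \<Longrightarrow> 0 \<le> L P \<and> L P \<le> real (length P)"
proof (induction rule: grown.induct)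
  case (grown_step P w)
  then have "L (P @ [w]) = L P + cost b (move_kind P w)" by (intro L_step grown_tracked)
  moreover have "0 \<le> cost b k \<and> cost b k \<le> 1" for k using b_bounds by (auto simp: cost_def)
  ultimately show ?case using grown_step.IH by (smt (verit) length_append_singleton of_nat_Suc)
qed (simp add: L_start)

lemma V_phase_growth:
  obtains K where "K \<ge> 0" "\<And>P. P \<noteq> [] \<Longrightarrow> \<bar>V (phase P)\<bar> \<le> K * real (length P)"
proof -
  obtain K where K: "K \<ge> 0" "\<And>s. \<bar>V s\<bar> \<le> K * (1 + real (index s))" using V_growth by blast
  have "\<bar>V (phase P)\<bar> \<le> K * real (length P)" if "P \<noteq> []" for P
    using K(2)[of "phase P"] index_phase[OF that] K(1)
      mult_left_mono[of "1 + real (index (phase P))" "real (length P)" K] by linarith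
  with K(1) show ?thesis by (rule that)
qed

lemma W_phase_growth:
  obtains K where "K \<ge> 0" "\<And>P. P \<noteq> [] \<Longrightarrow> \<bar>W (phase P)\<bar> \<le> K * (real (length P))\<^sup>2"
proof -
  obtain K where K: "K \<ge> 0" "\<And>s. \<bar>W s\<bar> \<le> K * (1 + real (index s))\<^sup>2" using W_growth by blast
  have "\<bar>W (phase P)\<bar> \<le> K * (real (length P))\<^sup>2" if "P \<noteq> []" for P
  proof -
    have "(1 + real (index (phase P)))\<^sup>2 \<le> (real (length P))\<^sup>2"
      using index_phase[OF that] by (intro power_mono) auto
    then show ?thesis using K(2)[of "phase P"] mult_left_mono[OF _ K(1)] by (meson order_trans)
  qed
  with K(1) show ?thesis by (rule that)
qed

lemma first_growth: "\<exists>K. \<forall>P. grown ladder_adj v0 P \<longrightarrow> \<bar>first P\<bar> \<le> K * (real (length P))\<^sup>2"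
proof -
  obtain K where K: "K \<ge> 0" "\<And>P. P \<noteq> [] \<Longrightarrow> \<bar>V (phase P)\<bar> \<le> K * real (length P)"
    using V_phase_growth by blast
  have "\<bar>first P\<bar> \<le> (1 + K) * (real (length P))\<^sup>2" if P: "grown ladder_adj v0 P" for P
  proof -
    have ne: "P \<noteq> []" using grown_tracked[OF P] by (simp add: tracked_def)
    have "\<bar>first P\<bar> \<le> (1 + K) * real (length P)"
      using L_bounds[OF P] K(2)[OF ne] unfolding first_def distrib_right by linarith
    also have "\<dots> \<le> (1 + K) * (real (length P))\<^sup>2"
      using ne K(1) by (intro mult_left_mono) (auto simp: power2_eq_square Suc_le_eq)
    finally show ?thesis .
  qed
  then show ?thesis by blast
qed

lemma second_growth: "\<exists>K. \<forall>P. grown ladder_adj v0 P \<longrightarrow> \<bar>second P\<bar> \<le> K * (real (length P))\<^sup>2"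
proof -
  obtain K where K: "K \<ge> 0" "\<And>P. P \<noteq> [] \<Longrightarrow> \<bar>V (phase P)\<bar> \<le> K * real (length P)"
    using V_phase_growth by blast
  obtain K' where K': "K' \<ge> 0" "\<And>P. P \<noteq> [] \<Longrightarrow> \<bar>W (phase P)\<bar> \<le> K' * (real (length P))\<^sup>2"
    using W_phase_growth by blast
  have "\<bar>second P\<bar> \<le> (1 + 2 * K + K') * (real (length P))\<^sup>2" if P: "grown ladder_adj v0 P" for P
  proof -
    let ?l = "real (length P)"
    have ne: "P \<noteq> []" using grown_tracked[OF P] by (simp add: tracked_def)
    have "\<bar>second P\<bar> \<le> (L P)\<^sup>2 + 2 * (L P * \<bar>V (phase P)\<bar>) + \<bar>W (phase P)\<bar>"
      using L_bounds[OF P] abs_triangle_ineq[of "(L P)\<^sup>2 + 2 * L P * V (phase P)" "W (phase P)"]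
        abs_triangle_ineq[of "(L P)\<^sup>2" "2 * L P * V (phase P)"]
      by (simp add: second_def abs_mult)
    also have "\<dots> \<le> ?l\<^sup>2 + 2 * (?l * (K * ?l)) + K' * ?l\<^sup>2"
      using L_bounds[OF P] K(2)[OF ne] K'(2)[OF ne]
      by (intro add_mono mult_left_mono mult_mono power_mono) auto
    also have "\<dots> = (1 + 2 * K + K') * ?l\<^sup>2" by (simp add: algebra_simps power2_eq_square)
    finally show ?thesis .
  qed
  then show ?thesis by blast
qed

text \<open>
  A final path has phase \<open>Trapped 0\<close>, where \<open>V\<close> and \<open>W\<close> vanish, so there the two harmonic functions
  are the total cost and its square.
\<close>
lemma moments:
  assumes ends: "AE \<omega> in M. \<exists>n. avail ladder_adj (X n \<omega>) = {}"
    and sq: "integrable M (\<lambda>\<omega>. (real (steps \<omega>))\<^sup>2)"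
  shows "integrable M (\<lambda>\<omega>. L (final \<omega>))" "integrable M (\<lambda>\<omega>. (L (final \<omega>))\<^sup>2)"
    "expectation (\<lambda>\<omega>. L (final \<omega>)) = V (Straight 0)"
    "variance (\<lambda>\<omega>. L (final \<omega>)) = W (Straight 0) - (V (Straight 0))\<^sup>2"
proof -
  obtain K1 where K1: "\<And>P. grown ladder_adj v0 P \<Longrightarrow> \<bar>first P\<bar> \<le> K1 * (real (length P))\<^sup>2"
    using first_growth by blast
  obtain K2 where K2: "\<And>P. grown ladder_adj v0 P \<Longrightarrow> \<bar>second P\<bar> \<le> K2 * (real (length P))\<^sup>2"
    using second_growth by blast
  have "AE \<omega> in M. first (final \<omega>) = L (final \<omega>) \<and> second (final \<omega>) = (L (final \<omega>))\<^sup>2"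
    using ends AE_regular
  proof eventually_elim
    case (elim \<omega>)
    then have "phase (final \<omega>) = Trapped 0"
      using tracked_stuck[OF grown_tracked[OF regular_grown]] avail_final by blast
    then show ?case by (simp add: first_def second_def)
  qed
  then have eq: "AE \<omega> in M. first (final \<omega>) = L (final \<omega>)" "AE \<omega> in M. second (final \<omega>) = (L (final \<omega>))\<^sup>2"
    by auto
  note 1 = optional_stopping[OF harmonic_first ends sq K1]
  note 2 = optional_stopping[OF harmonic_second ends sq K2]
  show i1: "integrable M (\<lambda>\<omega>. L (final \<omega>))"
    using integrable_cong_AE[OF borel_measurable_final borel_measurable_final[of L] eq(1)] 1(1) by simp
  show i2: "integrable M (\<lambda>\<omega>. (L (final \<omega>))\<^sup>2)"
    using integrable_cong_AE[OF borel_measurable_final borel_measurable_final[of "\<lambda>P. (L P)\<^sup>2"] eq(2)] 2(1) by simp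
  show e1: "expectation (\<lambda>\<omega>. L (final \<omega>)) = V (Straight 0)"
    using integral_cong_AE[OF borel_measurable_final borel_measurable_final[of L] eq(1)] 1(2)
    by (simp add: first_def L_start phase_single)
  have e2: "expectation (\<lambda>\<omega>. (L (final \<omega>))\<^sup>2) = W (Straight 0)"
    using integral_cong_AE[OF borel_measurable_final borel_measurable_final[of "\<lambda>P. (L P)\<^sup>2"] eq(2)] 2(2)
    by (simp add: second_def L_start phase_single)
  show "variance (\<lambda>\<omega>. L (final \<omega>)) = W (Straight 0) - (V (Straight 0))\<^sup>2"
    using variance_eq[OF i1 i2] unfolding e1 e2 .
qed

end

context ladder_gsaw
begin

lemma ladder_cost_steps: "ladder_cost M C 1 v0 X (\<lambda>P. real (length P) - 1)"
  by unfold_locales (auto simp: C_pos cost_def)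

lemma ladder_cost_width: "ladder_cost M C 0 v0 X (\<lambda>P. real_of_int (path_width P))"
proof unfold_locales
  show "real_of_int (path_width [v0]) = 0" by (simp add: path_width_def)
qed (auto simp: C_pos cost_def tracked_step(2))

text \<open>
  For the number of steps the cost so far is the length minus 1, and since the moments of the cost
  to come are nonnegative, the second harmonic function is at least the squared number of steps.
\<close>
lemma terminates:
  "AE \<omega> in M. \<exists>n. avail ladder_adj (X n \<omega>) = {}" "integrable M (\<lambda>\<omega>. (real (steps \<omega>))\<^sup>2)"
proof -
  interpret S: ladder_cost M C 1 v0 X "\<lambda>P. real (length P) - 1" by (rule ladder_cost_steps)
  have "(real (length P) - 1)\<^sup>2 \<le> S.second P" if "grown ladder_adj v0 P" for P
    using S.V_nonneg[of "phase P"] S.W_nonneg[of "phase P"] grown_tracked[OF that]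
    by (cases P) (auto simp: S.second_def tracked_def)
  from AE_terminates[OF S.harmonic_second this]
  show "AE \<omega> in M. \<exists>n. avail ladder_adj (X n \<omega>) = {}" "integrable M (\<lambda>\<omega>. (real (steps \<omega>))\<^sup>2)"
    by auto
qed

end

theorem corollary2p61:
  fixes M :: "'w measure" and C :: real and v0 :: "int \<times> nat"
    and X :: "nat \<Rightarrow> 'w \<Rightarrow> (int \<times> nat) list"
  assumes "C > 0" and "v0 \<in> ladder_verts" and "gsaw M ladder_adj C v0 X"
  shows "(AE \<omega> in M. \<exists>n. avail ladder_adj (X n \<omega>) = {})
    \<and> integrable M (\<lambda>\<omega>. real (num_steps ladder_adj X \<omega>))
    \<and> integrable M (\<lambda>\<omega>. (real (num_steps ladder_adj X \<omega>))\<^sup>2)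
    \<and> prob_space.expectation M (\<lambda>\<omega>. real (num_steps ladder_adj X \<omega>)) =
        2 * (6 * C^5 + 41 * C^4 + 56 * C^3 + 51 * C^2 + 38 * C + 12)
          / (3 * C * (C + 1) * (2 * C^2 + C + 1))
    \<and> prob_space.variance M (\<lambda>\<omega>. real (num_steps ladder_adj X \<omega>)) =
        2 * (72 * C^10 + 360 * C^9 + 1312 * C^8 + 2975 * C^7 + 4693 * C^6 + 5864 * C^5
             + 5822 * C^4 + 4551 * C^3 + 2773 * C^2 + 1242 * C + 288)
          / (9 * C^2 * (C + 1)^2 * (2 * C^2 + C + 1)^2)
    \<and> integrable M (\<lambda>\<omega>. real_of_int (final_width X \<omega>))
    \<and> integrable M (\<lambda>\<omega>. (real_of_int (final_width X \<omega>))\<^sup>2)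
    \<and> prob_space.expectation M (\<lambda>\<omega>. real_of_int (final_width X \<omega>)) =
        (6 * C^4 + 32 * C^3 + 28 * C^2 + 28 * C + 18) / (6 * C^3 + 3 * C^2 + 3 * C)
    \<and> prob_space.variance M (\<lambda>\<omega>. real_of_int (final_width X \<omega>)) =
        2 * (18 * C^8 + 54 * C^7 + 229 * C^6 + 445 * C^5 + 590 * C^4 + 686 * C^3
             + 541 * C^2 + 315 * C + 162)
          / (9 * C^2 * (2 * C^2 + C + 1)^2)"
proof -
  interpret gsaw M ladder_adj C v0 X by fact
  interpret ladder_gsaw M C v0 X
    using assms by unfold_locales (auto intro: finite_ladder_adj)
  interpret S: ladder_cost M C 1 v0 X "\<lambda>P. real (length P) - 1" by (rule ladder_cost_steps)
  interpret T: ladder_cost M C 0 v0 X "\<lambda>P. real_of_int (path_width P)" by (rule ladder_cost_width)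
  note S = S.moments[OF terminates] and T = T.moments[OF terminates]
  have len: "AE \<omega> in M. real (length (final \<omega>)) - 1 = real (steps \<omega>)"
    using AE_regular by eventually_elim (simp add: length_final)
  have steps_meas [measurable]: "(\<lambda>\<omega>. real (steps \<omega>)) \<in> borel_measurable M" by measurable
  have iS: "integrable M (\<lambda>\<omega>. real (steps \<omega>))"
    using integrable_cong_AE[OF borel_measurable_final steps_meas len] S(1) by blast
  have ES: "expectation (\<lambda>\<omega>. real (steps \<omega>)) = S.V (Straight 0)"
    using integral_cong_AE[OF borel_measurable_final steps_meas len] S(3) by (rule trans[OF sym])
  have vS: "variance (\<lambda>\<omega>. real (steps \<omega>)) = S.W (Straight 0) - (S.V (Straight 0))\<^sup>2"
  proof -
    have "variance (\<lambda>\<omega>. real (steps \<omega>)) = variance (\<lambda>\<omega>. real (length (final \<omega>)) - 1)"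
    proof (rule integral_cong_AE)
      show "AE \<omega> in M. (real (steps \<omega>) - expectation (\<lambda>\<omega>. real (steps \<omega>)))\<^sup>2 =
          (real (length (final \<omega>)) - 1 - expectation (\<lambda>\<omega>. real (length (final \<omega>)) - 1))\<^sup>2"
        using len unfolding ES S(3) by eventually_elim simp
      show "(\<lambda>\<omega>. (real (length (final \<omega>)) - 1 - expectation (\<lambda>\<omega>. real (length (final \<omega>)) - 1))\<^sup>2)
          \<in> borel_measurable M"
        by (rule borel_measurable_final)
    qed measurable
    then show ?thesis using S(4) by (rule trans)
  qed
  have WS: "S.W (Straight 0) - (S.V (Straight 0))\<^sup>2 =
      2 * (72 * C^10 + 360 * C^9 + 1312 * C^8 + 2975 * C^7 + 4693 * C^6 + 5864 * C^5
             + 5822 * C^4 + 4551 * C^3 + 2773 * C^2 + 1242 * C + 288)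
          / (9 * C^2 * (C + 1)^2 * (2 * C^2 + C + 1)^2)"
    unfolding S.steps_W[OF refl] S.steps_values(5)[OF refl]
    using S.denominators by (simp add: divide_simps) algebra
  have VS: "S.V (Straight 0) = 2 * (6 * C^5 + 41 * C^4 + 56 * C^3 + 51 * C^2 + 38 * C + 12)
          / (3 * C * (C + 1) * (2 * C^2 + C + 1))"
    unfolding S.steps_values(5)[OF refl] by (simp only: add.commute[of C 1] flip: distrib_left) simp
  have WT: "T.W (Straight 0) - (T.V (Straight 0))\<^sup>2 =
      2 * (18 * C^8 + 54 * C^7 + 229 * C^6 + 445 * C^5 + 590 * C^4 + 686 * C^3
             + 541 * C^2 + 315 * C + 162)
          / (9 * C^2 * (2 * C^2 + C + 1)^2)"
    unfolding T.width_W[OF refl] T.width_values(5)[OF refl]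
    using T.denominators by (simp add: divide_simps) algebra
  have VT: "T.V (Straight 0) = (6 * C^4 + 32 * C^3 + 28 * C^2 + 28 * C + 18) / (6 * C^3 + 3 * C^2 + 3 * C)"
  proof -
    have "3 * C * (2 * C^2 + C + 1) = 6 * C^3 + 3 * C^2 + 3 * C" by algebra
    then show ?thesis unfolding T.width_values(5)[OF refl] by simp
  qed
  show ?thesis
    unfolding final_width_def
    using terminates iS ES[unfolded VS] vS[unfolded WS] T(1,2) T(3)[unfolded VT] T(4)[unfolded WT]
    by (intro conjI)
qed

end
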